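(* Let $G$ be a finitely generated group. Then there exists a finite generating set $S$ of $G$ such that the skeleton $X_{G,S}$ is a subshift of finite type if and only if $G$ is a plain group.
   Context: All generating sets $S$ of a group $G$ are finite, symmetric ($S=S^{-1}$) and do not contain the identity $1_G$. For a word $w\in S^*$, $\overline{w}\in G$ denotes the group element it represents. A factor of a (finite or bi-infinite) word is a finite contiguous subword. The skeleton of $G$ with respect to $S$ is $X_{G,S}=\{x\in S^{\mathbb{Z}} : \overline{w}\neq 1_G \text{ for every nonempty finite factor } w \text{ of } x\}$ (equivalently, the set of labels of bi-infinite self-avoiding walks on the Cayley graph of $(G,S)$ passing through $1_G$ at time $0$). For a finite alphabet $A$ and a set $\mathcal{F}$ of finite words over $A$, let $\mathcal{X}_{\mathcal{F}}$ be the set of $x\in A^{\mathbb{Z}}$ having no factor in $\mathcal{F}$; a subshift is a set of this form (possibly empty), and it is a subshift of finite type (SFT) if it equals $\mathcal{X}_{\mathcal{F}}$ for some finite $\mathcal{F}$. A group is plain if it is isomorphic to a free product $G_1\ast\cdots\ast G_k\ast\mathbb{F}_m$ where $k\ge 0$, $m\ge 0$, the $G_i$ are finite groups and $\mathbb{F}_m$ is the free group of rank $m$. *)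

theory Defs
  imports "HOL-Algebra.Generated_Groups"
begin

section \<open>Subshifts of finite type\<close>

text \<open>Bi-infinite words over \<open>A\<close> are functions \<open>x :: int \<Rightarrow> 'a\<close> with \<open>range x \<subseteq> A\<close>.
  Since \<^term>\<open>[i..j]\<close> is empty for \<open>j < i\<close>, the empty word is a factor of every \<open>x\<close>.\<close>

definition factor_of :: "'a list \<Rightarrow> (int \<Rightarrow> 'a) \<Rightarrow> bool" where
  "factor_of w x \<longleftrightarrow> (\<exists>i j. w = map x [i..j])"

definition avoiding_shift :: "'a set \<Rightarrow> 'a list set \<Rightarrow> (int \<Rightarrow> 'a) set" where
  "avoiding_shift A F = {x. range x \<subseteq> A \<and> (\<forall>w\<in>F. \<not> factor_of w x)}"

definition SFT :: "'a set \<Rightarrow> (int \<Rightarrow> 'a) set \<Rightarrow> bool" where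
  "SFT A X \<longleftrightarrow> finite A \<and> (\<exists>F. finite F \<and> F \<subseteq> lists A \<and> X = avoiding_shift A F)"

section \<open>Generating sets and skeletons\<close>

definition finitely_generated :: "('a, 'b) monoid_scheme \<Rightarrow> bool" where
  "finitely_generated G \<longleftrightarrow> (\<exists>S. finite S \<and> S \<subseteq> carrier G \<and> generate G S = carrier G)"

definition generating_set :: "('a, 'b) monoid_scheme \<Rightarrow> 'a set \<Rightarrow> bool" where
  "generating_set G S \<longleftrightarrow>
     finite S \<and> S \<subseteq> carrier G \<and> \<one>\<^bsub>G\<^esub> \<notin> S \<and> m_inv G ` S = S \<and> generate G S = carrier G"

definition word_value :: "('a, 'b) monoid_scheme \<Rightarrow> 'a list \<Rightarrow> 'a" where
  "word_value G w = foldr (mult G) w \<one>\<^bsub>G\<^esub>"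

definition skeleton :: "('a, 'b) monoid_scheme \<Rightarrow> 'a set \<Rightarrow> (int \<Rightarrow> 'a) set" where
  "skeleton G S =
     {x. range x \<subseteq> S \<and> (\<forall>w. factor_of w x \<and> w \<noteq> [] \<longrightarrow> word_value G w \<noteq> \<one>\<^bsub>G\<^esub>)}"

section \<open>Free products\<close>

text \<open>The free product of the groups \<open>G i\<close>, \<open>i \<in> I\<close>, is realised on reduced words: lists of
  syllables \<open>(i, g)\<close> with \<open>i \<in> I\<close> and \<open>g\<close> a non-identity element of \<open>G i\<close>, consecutive syllables
  coming from different factors. The product is concatenation followed by reduction, carried out
  by multiplying the syllables of the left word one by one onto the right word.\<close>

definition fp_words :: "'i set \<Rightarrow> ('i \<Rightarrow> 'a monoid) \<Rightarrow> ('i \<times> 'a) list set" where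
  "fp_words I G =
     {w. (\<forall>(i, g)\<in>set w. i \<in> I \<and> g \<in> carrier (G i) \<and> g \<noteq> \<one>\<^bsub>G i\<^esub>)
         \<and> successively (\<lambda>p q. fst p \<noteq> fst q) w}"

definition fp_cons :: "('i \<Rightarrow> 'a monoid) \<Rightarrow> 'i \<times> 'a \<Rightarrow> ('i \<times> 'a) list \<Rightarrow> ('i \<times> 'a) list" where
  "fp_cons G = (\<lambda>(i, g) w.
     if g = \<one>\<^bsub>G i\<^esub> then w
     else case w of
       [] \<Rightarrow> [(i, g)]
     | (j, h) # v \<Rightarrow>
         if j \<noteq> i then (i, g) # w
         else if g \<otimes>\<^bsub>G i\<^esub> h = \<one>\<^bsub>G i\<^esub> then v
         else (i, g \<otimes>\<^bsub>G i\<^esub> h) # v)"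

definition free_product :: "'i set \<Rightarrow> ('i \<Rightarrow> 'a monoid) \<Rightarrow> ('i \<times> 'a) list monoid" where
  "free_product I G =
     \<lparr>carrier = fp_words I G, mult = (\<lambda>u v. foldr (fp_cons G) u v), one = []\<rparr>"

section \<open>Free groups\<close>

text \<open>The letter \<open>(i, True)\<close> is the \<open>i\<close>-th free generator and \<open>(i, False)\<close> its inverse.\<close>

definition letter_inv :: "nat \<times> bool \<Rightarrow> nat \<times> bool" where
  "letter_inv s = (fst s, \<not> snd s)"

definition fg_words :: "nat \<Rightarrow> (nat \<times> bool) list set" where
  "fg_words m = {w. fst ` set w \<subseteq> {..<m} \<and> successively (\<lambda>s t. t \<noteq> letter_inv s) w}"

definition fg_cons :: "nat \<times> bool \<Rightarrow> (nat \<times> bool) list \<Rightarrow> (nat \<times> bool) list" where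
  "fg_cons s w = (case w of [] \<Rightarrow> [s] | t # v \<Rightarrow> if t = letter_inv s then v else s # w)"

definition free_group :: "nat \<Rightarrow> (nat \<times> bool) list monoid" where
  "free_group m = \<lparr>carrier = fg_words m, mult = (\<lambda>u v. foldr fg_cons u v), one = []\<rparr>"

section \<open>Plain groups\<close>

text \<open>The factors \<open>H 0, \<dots>, H (k - 1)\<close> are the finite groups and the factor with index \<open>k\<close> is the
  free group. A family has a single element type, so the finite groups are taken on the
  (infinite) element type of the free group; every finite group has an isomorphic copy there.\<close>

definition plain_group :: "('a, 'b) monoid_scheme \<Rightarrow> bool" where
  "plain_group G \<longleftrightarrow>
     (\<exists>(k::nat) (m::nat) (H :: nat \<Rightarrow> (nat \<times> bool) list monoid).
        (\<forall>i<k. group (H i) \<and> finite (carrier (H i))) \<and>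
        G \<cong> free_product {..k} (H(k := free_group m)))"

section \<open>The constructions are groups\<close>

lemma fp_words_Nil: "[] \<in> fp_words I G"
  by (simp add: fp_words_def)

lemma fp_words_Cons:
  "p # w \<in> fp_words I G \<longleftrightarrow>
     fst p \<in> I \<and> snd p \<in> carrier (G (fst p)) \<and> snd p \<noteq> \<one>\<^bsub>G (fst p)\<^esub> \<and>
     w \<in> fp_words I G \<and> (w \<noteq> [] \<longrightarrow> fst p \<noteq> fst (hd w))"
  by (cases w) (auto simp: fp_words_def split: prod.splits)

lemma fp_cons_eq_Cons: "p # w \<in> fp_words I G \<Longrightarrow> fp_cons G p w = p # w"
  by (cases w) (auto simp: fp_words_Cons fp_cons_def split: prod.splits)

context
  fixes I :: "'i set" and G :: "'i \<Rightarrow> 'a monoid"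
  assumes grp: "\<And>i. i \<in> I \<Longrightarrow> group (G i)"
begin

lemma fp_cons_closed:
  assumes "i \<in> I" "g \<in> carrier (G i)" "w \<in> fp_words I G"
  shows "fp_cons G (i, g) w \<in> fp_words I G"
proof -
  interpret group "G i" using grp assms(1) .
  show ?thesis
    using assms
    by (cases w) (auto simp: fp_words_Cons fp_words_Nil fp_cons_def split: if_splits)
qed

lemma fp_cons_cons:
  assumes i: "i \<in> I" and g: "g \<in> carrier (G i)" and h: "h \<in> carrier (G i)"
    and w: "w \<in> fp_words I G"
  shows "fp_cons G (i, g) (fp_cons G (i, h) w) = fp_cons G (i, g \<otimes>\<^bsub>G i\<^esub> h) w"
proof -
  interpret group "G i" using grp i .
  consider "w = [] \<or> fst (hd w) \<noteq> i" | a v where "w = (i, a) # v"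
    by (metis list.collapse prod.collapse)
  then show ?thesis
  proof cases
    case 1
    then show ?thesis using g h
      by (cases w) (auto simp: fp_cons_def)
  next
    case 2
    have a: "a \<in> carrier (G i)" "a \<noteq> \<one>\<^bsub>G i\<^esub>" and v: "v = [] \<or> fst (hd v) \<noteq> i"
      using w 2 by (auto simp: fp_words_Cons)
    have eq: "fp_cons G (i, b) w = (if b \<otimes>\<^bsub>G i\<^esub> a = \<one>\<^bsub>G i\<^esub> then v else (i, b \<otimes>\<^bsub>G i\<^esub> a) # v)"
      if "b \<in> carrier (G i)" for b
      using that a 2 by (auto simp: fp_cons_def)
    show ?thesis
    proof (cases "h \<otimes>\<^bsub>G i\<^esub> a = \<one>\<^bsub>G i\<^esub>")
      case True
      have "g \<otimes>\<^bsub>G i\<^esub> h \<otimes>\<^bsub>G i\<^esub> a = g"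
        using True g h a by (simp add: m_assoc)
      then show ?thesis
        using True v g h by (cases v) (auto simp: eq, auto simp: fp_cons_def)
    next
      case False
      then show ?thesis
        using g h a by (auto simp: eq m_assoc) (auto simp: fp_cons_def)
    qed
  qed
qed

lemma fp_mult_closed:
  "u \<in> fp_words I G \<Longrightarrow> v \<in> fp_words I G \<Longrightarrow> foldr (fp_cons G) u v \<in> fp_words I G"
  by (induction u) (auto simp: fp_words_Cons intro: fp_cons_closed)

lemma fp_mult_cons:
  assumes i: "i \<in> I" and g: "g \<in> carrier (G i)"
    and v: "v \<in> fp_words I G" and w: "w \<in> fp_words I G"
  shows "foldr (fp_cons G) (fp_cons G (i, g) v) w = fp_cons G (i, g) (foldr (fp_cons G) v w)"
proof -
  interpret group "G i" using grp i .
  have one: "fp_cons G (i, \<one>\<^bsub>G i\<^esub>) x = x" for x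
    by (simp add: fp_cons_def)
  show ?thesis
  proof (cases v)
    case Nil
    then show ?thesis by (simp add: fp_cons_def)
  next
    case (Cons p v')
    obtain j a where p: "p = (j, a)" by (cases p)
    show ?thesis
    proof (cases "j = i")
      case True
      have a: "a \<in> carrier (G i)" and v': "v' \<in> fp_words I G"
        using v Cons p True by (auto simp: fp_words_Cons)
      have eq: "fp_cons G (i, g) (foldr (fp_cons G) v w)
          = fp_cons G (i, g \<otimes>\<^bsub>G i\<^esub> a) (foldr (fp_cons G) v' w)"
        using fp_cons_cons[OF i g a fp_mult_closed[OF v' w]] Cons p True by simp
      consider "g = \<one>\<^bsub>G i\<^esub>" | "g \<noteq> \<one>\<^bsub>G i\<^esub>" "g \<otimes>\<^bsub>G i\<^esub> a = \<one>\<^bsub>G i\<^esub>"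
        | "g \<noteq> \<one>\<^bsub>G i\<^esub>" "g \<otimes>\<^bsub>G i\<^esub> a \<noteq> \<one>\<^bsub>G i\<^esub>"
        by blast
      then show ?thesis
      proof cases
        case 1
        then show ?thesis by (simp only: one)
      next
        case 2
        then have "fp_cons G (i, g) v = v'"
          using Cons p True by (simp add: fp_cons_def)
        then show ?thesis using eq 2 one by simp
      next
        case 3
        then have "fp_cons G (i, g) v = (i, g \<otimes>\<^bsub>G i\<^esub> a) # v'"
          using Cons p True by (simp add: fp_cons_def)
        then show ?thesis using eq by simp
      qed
    next
      case False
      have "fp_cons G (i, g) v = (if g = \<one>\<^bsub>G i\<^esub> then v else (i, g) # v)"
        using Cons p False by (simp add: fp_cons_def)
      then show ?thesis
        using one by simp
    qed
  qed
qed

lemma fp_mult_assoc: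
  "u \<in> fp_words I G \<Longrightarrow> v \<in> fp_words I G \<Longrightarrow> w \<in> fp_words I G \<Longrightarrow>
   foldr (fp_cons G) (foldr (fp_cons G) u v) w = foldr (fp_cons G) u (foldr (fp_cons G) v w)"
  by (induction u) (auto simp: fp_words_Cons fp_mult_cons fp_mult_closed)

lemma fp_left_inverse:
  "u \<in> fp_words I G \<Longrightarrow> \<exists>v\<in>fp_words I G. foldr (fp_cons G) v u = []"
proof (induction u)
  case Nil
  then show ?case by (auto intro!: bexI[of _ "[]"] simp: fp_words_Nil)
next
  case (Cons p u)
  obtain i g where p: "p = (i, g)" by (cases p)
  have i: "i \<in> I" and g: "g \<in> carrier (G i)" "g \<noteq> \<one>\<^bsub>G i\<^esub>" and u: "u \<in> fp_words I G"
    using Cons.prems p by (auto simp: fp_words_Cons)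
  interpret group "G i" using grp i .
  obtain v where v: "v \<in> fp_words I G" "foldr (fp_cons G) v u = []"
    using Cons.IH u by blast
  let ?q = "[(i, inv\<^bsub>G i\<^esub> g)]"
  have q: "?q \<in> fp_words I G"
    using i g by (auto simp: fp_words_Cons fp_words_Nil)
  have "foldr (fp_cons G) ?q (p # u) = u"
    using g p by (simp add: fp_cons_def)
  then have "foldr (fp_cons G) (foldr (fp_cons G) v ?q) (p # u) = []"
    using fp_mult_assoc[OF v(1) q Cons.prems] v by simp
  then show ?case
    using fp_mult_closed[OF v(1) q] by blast
qed

lemma group_free_product: "group (free_product I G)"
  by (rule groupI)
    (auto simp: free_product_def fp_words_Nil fp_mult_closed fp_mult_assoc intro: fp_left_inverse)

end

lemma letter_inv_inv [simp]: "letter_inv (letter_inv s) = s"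
  by (simp add: letter_inv_def)

lemma fg_words_Nil: "[] \<in> fg_words m"
  by (simp add: fg_words_def)

lemma fg_words_Cons:
  "s # w \<in> fg_words m \<longleftrightarrow>
     fst s < m \<and> w \<in> fg_words m \<and> (w \<noteq> [] \<longrightarrow> hd w \<noteq> letter_inv s)"
  by (cases w) (auto simp: fg_words_def)

lemma fg_cons_closed: "fst s < m \<Longrightarrow> w \<in> fg_words m \<Longrightarrow> fg_cons s w \<in> fg_words m"
  by (cases w) (auto simp: fg_words_Cons fg_words_Nil fg_cons_def)

lemma fg_cons_cancel:
  "w \<in> fg_words m \<Longrightarrow> fg_cons s (fg_cons (letter_inv s) w) = w"
  by (cases w) (auto simp: fg_words_Cons fg_cons_def neq_Nil_conv split: list.splits)

lemma fg_mult_closed: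
  "u \<in> fg_words m \<Longrightarrow> v \<in> fg_words m \<Longrightarrow> foldr fg_cons u v \<in> fg_words m"
  by (induction u) (auto simp: fg_words_Cons intro: fg_cons_closed)

lemma fg_mult_cons:
  assumes "v \<in> fg_words m" "w \<in> fg_words m"
  shows "foldr fg_cons (fg_cons s v) w = fg_cons s (foldr fg_cons v w)"
proof (cases v)
  case Nil
  then show ?thesis by (simp add: fg_cons_def)
next
  case (Cons t v')
  have v': "v' \<in> fg_words m"
    using assms Cons by (simp add: fg_words_Cons)
  show ?thesis
  proof (cases "t = letter_inv s")
    case True
    then show ?thesis
      using Cons fg_cons_cancel[OF fg_mult_closed[OF v' assms(2)]]
      by (simp add: fg_cons_def[of s "_ # _"])
  next
    case False
    then have "fg_cons s v = s # v"
      using Cons by (simp add: fg_cons_def)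
    then show ?thesis by simp
  qed
qed

lemma fg_mult_assoc:
  "u \<in> fg_words m \<Longrightarrow> v \<in> fg_words m \<Longrightarrow> w \<in> fg_words m \<Longrightarrow>
   foldr fg_cons (foldr fg_cons u v) w = foldr fg_cons u (foldr fg_cons v w)"
  by (induction u) (auto simp: fg_words_Cons fg_mult_closed fg_mult_cons[of _ m])

lemma fg_left_inverse: "u \<in> fg_words m \<Longrightarrow> \<exists>v\<in>fg_words m. foldr fg_cons v u = []"
proof (induction u)
  case Nil
  then show ?case by (auto intro!: bexI[of _ "[]"] simp: fg_words_Nil)
next
  case (Cons s u)
  then obtain v where v: "v \<in> fg_words m" "foldr fg_cons v u = []"
    by (auto simp: fg_words_Cons)
  let ?q = "[letter_inv s]"
  have q: "?q \<in> fg_words m"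
    using Cons.prems by (auto simp: fg_words_Cons fg_words_Nil letter_inv_def)
  have "foldr fg_cons ?q (s # u) = u"
    by (simp add: fg_cons_def)
  then have "foldr fg_cons (foldr fg_cons v ?q) (s # u) = []"
    using fg_mult_assoc[OF v(1) q Cons.prems] v by simp
  then show ?case
    using fg_mult_closed[OF v(1) q] by blast
qed

lemma group_free_group: "group (free_group m)"
  by (rule groupI)
    (auto simp: free_group_def fg_words_Nil fg_mult_closed fg_mult_assoc intro: fg_left_inverse)

end

(* Call a word a simple loop if it has value 1 and no proper nonempty factor has value 1.

   If the skeleton is of finite type, repeat a long simple loop periodically. By compactness each
   of its short windows occurs in the skeleton, because it extends far in both directions without
   closing up; so the periodic word lies in the skeleton, which is absurd. Hence simple loops have
   bounded length. Let P be the set of all g such that no vertex of the Cayley graph separates 1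
   from g. By Whitney's argument g lies on a common cycle with 1, so P is finite, and every
   loop over P contains two consecutive letters with product in P: P is a "block set" (the
   vertices of the blocks through 1).
   The elements of P are the arrows of a finite groupoid whose objects are the blocks through 1,
   and G is presented by its composition. A finite groupoid consists of vertex groups and of links
   from a base object of each component to the other objects, so G is the free product of finitely
   many finite groups and a free group.

   Conversely the letters of a free product form a block set, and for every block set P the simple
   loops over P - {1} have all their prefixes in P, hence bounded length, so that forbidding them
   is a condition of finite type. *)

theory Submission
  imports Defs "HOL-Library.Sublist"
begin


section \<open>Words and simple loops\<close>

text \<open>The skeleton only sees words that extend to bi-infinite ones: a forbidden word may
  contain no loop and still be a dead end, and the skeleton may even be empty. So a forbidden word
  inside the periodic word has to be refuted together with a margin on both sides, and only a length
  bound for simple loops, not the forbidden set itself, is passed on to the group. Inseparable pairs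
  replace blocks as subgraphs, which avoids a theory of blocks in infinite graphs: inseparability is
  visibly invariant under translation, and what is needed of the block decomposition becomes axioms
  about products in \<open>P\<close>. That two blocks share at most one vertex is the axiom
  \<open>triple\<close>; that the blocks hang together like a tree is the axiom
  \<open>reduced\<close>. Both directions of the theorem meet in these axioms. They make the partial
  multiplication of \<open>P\<close> a presentation of \<open>G\<close>, so that a homomorphism out
  of \<open>G\<close> can be prescribed on \<open>P\<close>.\<close>

definition simple_loop :: "('a, 'b) monoid_scheme \<Rightarrow> 'a list \<Rightarrow> bool" where
  "simple_loop G w \<longleftrightarrow> w \<noteq> [] \<and> word_value G w = \<one>\<^bsub>G\<^esub> \<and>
     (\<forall>v. strict_sublist v w \<and> v \<noteq> [] \<longrightarrow> word_value G v \<noteq> \<one>\<^bsub>G\<^esub>)"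

lemma word_value_Nil [simp]: "word_value G [] = \<one>\<^bsub>G\<^esub>"
  by (simp add: word_value_def)

lemma word_value_Cons [simp]: "word_value G (a # w) = a \<otimes>\<^bsub>G\<^esub> word_value G w"
  by (simp add: word_value_def)

lemma strict_sublist_iff:
  "strict_sublist v w \<longleftrightarrow> (\<exists>p s. w = p @ v @ s \<and> (p \<noteq> [] \<or> s \<noteq> []))"
proof -
  have "p = [] \<and> s = []" if "v = p @ v @ s" for p s :: "'a list"
  proof -
    have "length v = length p + (length v + length s)"
      using arg_cong[OF that, of length] by simp
    then show ?thesis by simp
  qed
  then show ?thesis by (fastforce simp: strict_sublist_def sublist_def)
qed

lemma strict_sublist_length: "strict_sublist v w \<Longrightarrow> length v < length w"
  by (auto simp: strict_sublist_iff)

text \<open>Descending to a trivial proper factor as long as there is one ends in a simple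
  loop.\<close>

lemma simple_loop_sublist:
  assumes "w \<noteq> []" "word_value G w = \<one>\<^bsub>G\<^esub>"
  shows "\<exists>v. sublist v w \<and> simple_loop G v"
  using assms
proof (induction w rule: length_induct)
  case (1 w)
  show ?case
  proof (cases "simple_loop G w")
    case False
    then obtain v where v: "strict_sublist v w" "v \<noteq> []" "word_value G v = \<one>\<^bsub>G\<^esub>"
      using 1(2,3) by (auto simp: simple_loop_def)
    then show ?thesis
      using 1(1) strict_sublist_length[OF v(1)]
      by (meson strict_sublist_def sublist_order.order_trans)
  qed auto
qed

context group
begin

lemma word_value_closed [simp]: "set w \<subseteq> carrier G \<Longrightarrow> word_value G w \<in> carrier G"
  by (induction w) auto

lemma word_value_append:
  "set u \<subseteq> carrier G \<Longrightarrow> set v \<subseteq> carrier G \<Longrightarrow>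
   word_value G (u @ v) = word_value G u \<otimes> word_value G v"
  by (induction u) (auto simp: m_assoc)

lemma generate_eq_word_values:
  assumes "T \<subseteq> carrier G" "m_inv G ` T \<subseteq> T"
  shows "generate G T = word_value G ` lists T"
proof
  show "generate G T \<subseteq> word_value G ` lists T"
  proof
    fix g assume "g \<in> generate G T"
    then show "g \<in> word_value G ` lists T"
    proof (induction rule: generate.induct)
      case one
      then show ?case by (auto intro!: image_eqI[of _ _ "[]"])
    next
      case (incl h)
      then show ?case using assms by (auto intro!: image_eqI[of _ _ "[h]"])
    next
      case (inv h)
      then have "inv h \<in> T" using assms by blast
      then show ?case using assms by (auto intro!: image_eqI[of _ _ "[inv h]"])
    next
      case (eng h1 h2)
      then obtain u v where "u \<in> lists T" "v \<in> lists T" "h1 = word_value G u" "h2 = word_value G v"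
        by auto
      moreover from this have "set u \<subseteq> carrier G" "set v \<subseteq> carrier G"
        using assms(1) by auto
      ultimately show ?case
        using assms(1) by (auto intro!: image_eqI[of _ _ "u @ v"] simp: word_value_append)
    qed
  qed
next
  have "word_value G w \<in> generate G T" if "set w \<subseteq> T" for w
    using that by (induction w) (auto intro: generate.intros)
  then show "word_value G ` lists T \<subseteq> generate G T" by auto
qed

lemma inv_mult_eq_one_iff:
  assumes "x \<in> carrier G" "y \<in> carrier G"
  shows "inv x \<otimes> y = \<one> \<longleftrightarrow> x = y"
  using assms by (metis l_inv inv_inv inv_closed inv_equality)

text \<open>The two words are conjugate, so a closed walk may be started at any of its
  vertices.\<close>

lemma word_value_swap:
  assumes "set u \<subseteq> carrier G" "set v \<subseteq> carrier G"
  shows "word_value G (u @ v) = \<one> \<longleftrightarrow> word_value G (v @ u) = \<one>"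
  using assms inv_comm[of "word_value G u" "word_value G v"]
    inv_comm[of "word_value G v" "word_value G u"]
  by (auto simp: word_value_append)

end

section \<open>Block sets\<close>

text \<open>The axioms describe the union of the blocks through the identity in a graph whose blocks
  are arranged like a tree. In \<open>triple\<close>, the points \<open>\<one>\<close> and
  \<open>a \<otimes> b \<otimes> c\<close> both share blocks with the distinct points
  \<open>a\<close> and \<open>a \<otimes> b\<close>, so all four lie in one block.
  \<open>reduced\<close> excludes a closed walk that changes its block at every vertex. The basic
  examples are a finite group and \<open>{\<one>, t, inv t}\<close> in an infinite cyclic group
  generated by \<open>t\<close>.\<close>

locale block_set = group G for G :: "('a, 'b) monoid_scheme" (structure) +
  fixes P :: "'a set"
  assumes finite_P: "finite P"
    and P_carrier: "P \<subseteq> carrier G"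
    and one_P: "\<one> \<in> P"
    and inv_P: "a \<in> P \<Longrightarrow> inv a \<in> P"
    and generate_P: "generate G P = carrier G"
    and triple: "\<lbrakk>a \<in> P; b \<in> P; c \<in> P; b \<noteq> \<one>; a \<otimes> b \<in> P; b \<otimes> c \<in> P\<rbrakk> \<Longrightarrow> a \<otimes> b \<otimes> c \<in> P"
    and reduced: "\<lbrakk>set w \<subseteq> P - {\<one>}; w \<noteq> []; successively (\<lambda>a b. a \<otimes> b \<notin> P) w\<rbrakk> \<Longrightarrow>
      word_value G w \<noteq> \<one>"
begin

lemma P_closed [simp]: "a \<in> P \<Longrightarrow> a \<in> carrier G"
  using P_carrier by blast

lemma loop_reducible:
  assumes "set w \<subseteq> P - {\<one>}" "w \<noteq> []" "word_value G w = \<one>"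
  obtains u a b v where "w = u @ a # b # v" "a \<otimes> b \<in> P"
proof -
  have "\<not> successively (\<lambda>a b. a \<otimes> b \<notin> P) w"
    using reduced assms by blast
  then have "\<exists>u a b v. w = u @ a # b # v \<and> a \<otimes> b \<in> P"
  proof (induction w)
    case (Cons a w)
    show ?case
    proof (cases "\<exists>b v. w = b # v \<and> a \<otimes> b \<in> P")
      case True
      then show ?thesis by (metis append_Nil)
    next
      case False
      then have "\<not> successively (\<lambda>a b. a \<otimes> b \<notin> P) w"
        using Cons.prems by (cases w) auto
      then show ?thesis using Cons.IH by (metis append_Cons)
    qed
  qed auto
  then show ?thesis using that by blast
qed

text \<open>Merging two adjacent letters with product in \<open>P\<close> gives a shorter simple
  loop, because each of its factors has the value of a factor of \<open>w\<close>. Only the prefix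
  that ends between the merged letters is lost, and \<open>triple\<close> recovers it.\<close>

lemma simple_loop_prefixes:
  assumes "simple_loop G w" "set w \<subseteq> P - {\<one>}"
  shows "w = u @ v \<Longrightarrow> word_value G u \<in> P"
  using assms
proof (induction "length w" arbitrary: w u v rule: less_induct)
  case less
  note cl = simple_loop_def[of G]
  have w: "w \<noteq> []" "word_value G w = \<one>" and setw: "set w \<subseteq> P - {\<one>}"
    using less.prems by (auto simp: cl)
  have setc: "set w \<subseteq> carrier G" using setw by auto
  obtain x a b y where xy: "w = x @ a # b # y" "a \<otimes> b \<in> P"
    using loop_reducible[OF setw w] by metis
  have ab: "a \<in> P" "b \<in> P" "a \<noteq> \<one>" "b \<noteq> \<one>" and xyP: "set x \<subseteq> P - {\<one>}" "set y \<subseteq> P - {\<one>}"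
    using setw xy by auto
  have xyc: "set x \<subseteq> carrier G" "set y \<subseteq> carrier G" using xyP by auto
  show ?case
  proof (cases "a \<otimes> b = \<one>")
    case True
    \<comment> \<open>A trivial factor of a simple loop can only be the whole loop.\<close>
    have "sublist [a, b] w" using xy by (auto simp: sublist_def)
    moreover have "word_value G [a, b] = \<one>" using True ab by simp
    ultimately have "w = [a, b]"
      using less.prems(2) by (auto simp: cl strict_sublist_def)
    then have "u = [] \<or> u = [a] \<or> u = [a, b]"
      using less.prems(1) by (cases u; cases "tl u") (auto simp: Cons_eq_append_conv)
    then show ?thesis using True ab one_P by auto
  next
    case False
    let ?w = "x @ (a \<otimes> b) # y"
    have val: "word_value G ?w = \<one>"
      using w xy ab xyc by (simp add: word_value_append m_assoc)
    have "simple_loop G ?w"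
    proof -
      have "word_value G z \<noteq> \<one>" if z: "strict_sublist z ?w" "z \<noteq> []" for z
      proof -
        obtain p s where ps: "?w = p @ z @ s" "p \<noteq> [] \<or> s \<noteq> []"
          using z by (auto simp: strict_sublist_iff)
        have *: "word_value G q \<noteq> \<one>"
          if "w = p' @ q @ s'" "q \<noteq> []" "p' \<noteq> [] \<or> s' \<noteq> []" for p' q s'
        proof -
          have "strict_sublist q w"
            using that by (auto simp: strict_sublist_iff)
          then show ?thesis using less.prems(2) that(2) by (auto simp: cl)
        qed
        from ps(1) consider (1) r where "x = p @ z @ r" "s = r @ (a \<otimes> b) # y"
          | (2) r t where "z = r @ (a \<otimes> b) # t" "x = p @ r" "y = t @ s"
          | (3) r where "p = x @ (a \<otimes> b) # r" "y = r @ z @ s"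
          by (auto simp: append_eq_append_conv2 append_eq_Cons_conv Cons_eq_append_conv
              append_eq_append_conv2)
        then show ?thesis
        proof cases
          case 1
          then show ?thesis using *[of p z "r @ a # b # y"] xy z by auto
        next
          case 2
          have "word_value G z = word_value G (r @ a # b # t)"
            using 2 xyc ab by (simp add: word_value_append m_assoc)
          then show ?thesis using *[of p "r @ a # b # t" s] 2 xy ps by auto
        next
          case 3
          then show ?thesis using *[of "x @ a # b # r" z s] xy z by auto
        qed
      qed
      then show ?thesis using val by (auto simp: cl)
    qed
    moreover have "length ?w < length w" using xy by simp
    moreover have "set ?w \<subseteq> P - {\<one>}" using False xy ab xyP by auto
    ultimately have IH: "\<And>u v. ?w = u @ v \<Longrightarrow> word_value G u \<in> P"
      using less.hyps by blast
    from less.prems(1) xy(1) consider (1) r where "x = u @ r" | (2) "u = x @ [a]"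
      | (3) r where "u = x @ a # b # r" "y = r @ v"
      by (auto simp: append_eq_append_conv2 append_eq_Cons_conv Cons_eq_append_conv)
    then show ?thesis
    proof cases
      case 1
      then show ?thesis using IH[of u "r @ (a \<otimes> b) # y"] by simp
    next
      case 2
      have 1: "word_value G x \<in> P" using IH[of x] by simp
      have "word_value G (x @ [a \<otimes> b]) \<in> P" using IH[of "x @ [a \<otimes> b]"] by simp
      then have 2: "word_value G x \<otimes> (a \<otimes> b) \<in> P" using xyc ab by (simp add: word_value_append)
      have eq: "(a \<otimes> b) \<otimes> inv b = a" using ab by (simp add: m_assoc)
      \<comment> \<open>The middle factor \<open>a \<otimes> b\<close> is not the identity, and
        multiplied by \<open>inv b\<close> it gives \<open>a\<close>, so \<open>triple\<close>
        applies.\<close>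
      have "word_value G x \<otimes> (a \<otimes> b) \<otimes> inv b \<in> P"
        by (rule triple) (use 1 2 ab False xy eq inv_P in auto)
      then show ?thesis using eq \<open>u = x @ [a]\<close> ab xyc xy
        by (simp add: word_value_append m_assoc)
    next
      case 3
      have "word_value G (x @ (a \<otimes> b) # r) \<in> P" using IH[of "x @ (a \<otimes> b) # r" v] 3 by simp
      then show ?thesis using 3 ab xyc by (simp add: word_value_append m_assoc)
    qed
  qed
qed

text \<open>The proper prefixes inject into \<open>P\<close>: two with equal values would enclose a
  trivial proper factor.\<close>

lemma simple_loop_length:
  assumes "simple_loop G w" "set w \<subseteq> P - {\<one>}"
  shows "length w \<le> card P"
proof -
  let ?f = "\<lambda>i. word_value G (take i w)"
  have wc: "set w \<subseteq> carrier G" using assms(2) by auto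
  have "inj_on ?f {..<length w}"
  proof (rule linorder_inj_onI)
    fix i j assume ij: "i < j" "i \<in> {..<length w}" "j \<in> {..<length w}"
    let ?v = "take (j - i) (drop i w)"
    have tk: "take j w = take i w @ ?v"
      by (metis ij(1) less_imp_add_positive take_add diff_add_inverse)
    then have "w = take i w @ ?v @ drop j w" by (metis append_assoc append_take_drop_id)
    then have "sublist ?v w" unfolding sublist_def by metis
    moreover have "?v \<noteq> []" "?v \<noteq> w" using ij by (auto dest: arg_cong[of _ w length])
    ultimately have ne: "word_value G ?v \<noteq> \<one>"
      using assms(1) unfolding simple_loop_def strict_sublist_def by blast
    have c: "set (take i w) \<subseteq> carrier G" "set ?v \<subseteq> carrier G"
      using wc by (meson order_trans set_drop_subset set_take_subset)+
    show "?f i \<noteq> ?f j"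
      using ne c unfolding tk word_value_append[OF c] by simp
  qed auto
  moreover have "?f ` {..<length w} \<subseteq> P"
    using simple_loop_prefixes[of w] assms by (metis append_take_drop_id image_subsetI)
  ultimately show ?thesis
    using card_inj_on_le[of ?f "{..<length w}" P] finite_P by simp
qed

lemma generating_set_P: "generating_set G (P - {\<one>})"
proof -
  have inv: "m_inv G ` (P - {\<one>}) = P - {\<one>}"
  proof
    show sub: "m_inv G ` (P - {\<one>}) \<subseteq> P - {\<one>}" using inv_P by auto
    show "P - {\<one>} \<subseteq> m_inv G ` (P - {\<one>})"
    proof
      fix a assume "a \<in> P - {\<one>}"
      then have "inv a \<in> P - {\<one>}" "a = inv (inv a)" using sub by auto
      then show "a \<in> m_inv G ` (P - {\<one>})" by blast
    qed
  qed
  have "P \<subseteq> generate G (P - {\<one>})"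
    using generate.one[of G "P - {\<one>}"] generate.incl[of _ "P - {\<one>}" G] by blast
  then have "carrier G \<subseteq> generate G (P - {\<one>})"
    unfolding generate_P[symmetric]
    by (rule generate_subgroup_incl[OF _ generate_is_subgroup]) (use P_carrier in auto)
  then show ?thesis
    using inv finite_P P_carrier generate_incl[of "P - {\<one>}"]
    by (auto simp: generating_set_def)
qed

end

section \<open>Finite type from a bound on simple loops\<close>

lemma factor_of_sublist:
  assumes "factor_of w x" "sublist v w"
  shows "factor_of v x"
proof -
  obtain i j where w: "w = map x [i..j]" using assms(1) by (auto simp: factor_of_def)
  obtain p s where ps: "w = p @ v @ s" using assms(2) by (auto simp: sublist_def)
  let ?i = "i + int (length p)"
  show ?thesis
  proof (cases "v = []")
    case True
    \<comment> \<open>The interval from 1 to 0 is empty and realises the empty word.\<close>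
    then show ?thesis unfolding factor_of_def by (intro exI[of _ 1] exI[of _ 0]) simp
  next
    case False
    have len: "length w = nat (j - i + 1)" using w by simp
    then have l: "length p + length v + length s = nat (j - i + 1)" using ps by simp
    have "v = map x [?i..?i + int (length v) - 1]"
    proof (rule nth_equalityI)
      fix n assume n: "n < length v"
      have "v ! n = w ! (length p + n)" using n ps by (simp add: nth_append)
      also have "\<dots> = x (i + int (length p + n))"
        using n l w by (simp add: nth_upto)
      finally show "v ! n = map x [?i..?i + int (length v) - 1] ! n"
        using n by (simp add: nth_upto add.assoc)
    qed simp
    then show ?thesis unfolding factor_of_def by blast
  qed
qed

lemma set_factor_of: "factor_of w x \<Longrightarrow> set w \<subseteq> range x"
  by (auto simp: factor_of_def)

text \<open>The simple loops are the minimal forbidden words of the skeleton, because every nonempty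
  trivial word contains one.\<close>

lemma SFT_skeleton_if_simple_loops_bounded:
  assumes "finite S" and bounded: "\<And>w. simple_loop G w \<Longrightarrow> set w \<subseteq> S \<Longrightarrow> length w \<le> N"
  shows "SFT S (skeleton G S)"
proof -
  let ?F = "{w. set w \<subseteq> S \<and> length w \<le> N \<and> simple_loop G w}"
  have "skeleton G S = avoiding_shift S ?F"
  proof (intro equalityI subsetI)
    fix x assume "x \<in> skeleton G S"
    then show "x \<in> avoiding_shift S ?F"
      by (auto simp: skeleton_def avoiding_shift_def simple_loop_def)
  next
    fix x assume x: "x \<in> avoiding_shift S ?F"
    have False if w: "factor_of w x" "w \<noteq> []" "word_value G w = \<one>\<^bsub>G\<^esub>" for w
    proof -
      obtain v where v: "sublist v w" "simple_loop G v" using simple_loop_sublist[OF w(2,3)] by blast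
      have fv: "factor_of v x" using factor_of_sublist[OF w(1) v(1)] .
      moreover have "set v \<subseteq> S" using set_factor_of[OF fv] x by (auto simp: avoiding_shift_def)
      ultimately show False using x bounded[of v] v by (auto simp: avoiding_shift_def)
    qed
    then show "x \<in> skeleton G S"
      using x by (auto simp: skeleton_def avoiding_shift_def)
  qed
  moreover have "finite ?F"
    by (rule finite_subset[OF _ finite_lists_length_le[OF \<open>finite S\<close>, of N]]) auto
  ultimately show ?thesis
    unfolding SFT_def using \<open>finite S\<close> by (intro conjI exI[of _ ?F]) auto
qed


section \<open>From finite type to bounded simple loops\<close>

definition loop_free :: "('a, 'b) monoid_scheme \<Rightarrow> 'a list \<Rightarrow> bool" where
  "loop_free G w \<longleftrightarrow> (\<forall>v. sublist v w \<and> v \<noteq> [] \<longrightarrow> word_value G v \<noteq> \<one>\<^bsub>G\<^esub>)"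

text \<open>A finite approximation of occurring in the skeleton. Equal lengths on both sides turn
  the extensions of \<open>u\<close> into a tree that branches over
  \<open>S \<times> S\<close>.\<close>

definition extends_by :: "('a, 'b) monoid_scheme \<Rightarrow> 'a set \<Rightarrow> nat \<Rightarrow> 'a list \<Rightarrow> bool" where
  "extends_by G S n u \<longleftrightarrow>
     (\<exists>x y. length x = n \<and> length y = n \<and> set x \<subseteq> S \<and> set y \<subseteq> S \<and> loop_free G (x @ u @ y))"

lemma loop_free_sublist: "loop_free G w \<Longrightarrow> sublist v w \<Longrightarrow> loop_free G v"
  unfolding loop_free_def by (meson sublist_order.order_trans)

lemma extends_by_mono:
  assumes "extends_by G S n u" "m \<le> n"
  shows "extends_by G S m u"
proof -
  obtain x y where xy: "length x = n" "length y = n" "set x \<subseteq> S" "set y \<subseteq> S"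
      "loop_free G (x @ u @ y)"
    using assms(1) by (auto simp: extends_by_def)
  have "x @ u @ y = take (n - m) x @ (drop (n - m) x @ u @ take m y) @ drop m y"
    by (simp add: append_assoc[symmetric] del: append_assoc) (simp add: append_assoc)
  then have "sublist (drop (n - m) x @ u @ take m y) (x @ u @ y)"
    unfolding sublist_def by blast
  then have "loop_free G (drop (n - m) x @ u @ take m y)"
    using loop_free_sublist xy(5) by blast
  moreover have "set (drop (n - m) x) \<subseteq> S" "set (take m y) \<subseteq> S"
    using xy by (meson order_trans set_drop_subset set_take_subset)+
  ultimately show ?thesis
    unfolding extends_by_def
    by (intro exI[of _ "drop (n - m) x"] exI[of _ "take m y"]) (use xy assms(2) in auto)
qed

lemma extends_by_Suc:
  assumes "extends_by G S (Suc n) u"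
  obtains a b where "a \<in> S" "b \<in> S" "extends_by G S n (a # u @ [b])"
proof -
  obtain x y where xy: "length x = Suc n" "length y = Suc n" "set x \<subseteq> S" "set y \<subseteq> S"
      "loop_free G (x @ u @ y)"
    using assms by (auto simp: extends_by_def)
  obtain x' a where x: "x = x' @ [a]" using xy(1) by (cases x rule: rev_cases) auto
  obtain b y' where y: "y = b # y'" using xy(2) by (cases y) auto
  have "extends_by G S n (a # u @ [b])"
    unfolding extends_by_def
    by (intro exI[of _ x'] exI[of _ y']) (use xy x y in auto)
  then show ?thesis using that[of a b] xy x y by auto
qed

text \<open>One step of Koenig's lemma: if each pair of letters failed at some length, all of the
  finitely many pairs would fail at the largest of these lengths, against the extension of
  \<open>u\<close> by one more.\<close>

lemma extends_forever_step:
  assumes "finite S" and ext: "\<And>n. extends_by G S n u"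
  shows "\<exists>a\<in>S. \<exists>b\<in>S. \<forall>n. extends_by G S n (a # u @ [b])"
proof (rule ccontr)
  assume "\<not> ?thesis"
  then have "\<forall>p\<in>S \<times> S. \<exists>n. \<not> extends_by G S n (fst p # u @ [snd p])" by force
  then obtain f where f: "\<And>p. p \<in> S \<times> S \<Longrightarrow> \<not> extends_by G S (f p) (fst p # u @ [snd p])"
    by metis
  define N where "N = Max (f ` (S \<times> S))"
  obtain a b where ab: "a \<in> S" "b \<in> S" "extends_by G S N (a # u @ [b])"
    using extends_by_Suc[OF ext] by metis
  have "f (a, b) \<le> N"
    unfolding N_def using ab \<open>finite S\<close> by (intro Max_ge) auto
  then show False
    using extends_by_mono[OF ab(3)] f[of "(a, b)"] ab by auto
qed

lemma upto_append: "i \<le> j \<Longrightarrow> j \<le> k + 1 \<Longrightarrow> [i..k] = [i..j - 1] @ [j..k]"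
  by (cases "j \<le> k") (auto simp: upto_split1 intro!: arg_cong[of _ _ "upto i"])

lemma sublist_map_upto:
  assumes "i' \<le> i" "j \<le> j'"
  shows "sublist (map x [i..j]) (map x [i'..j'])"
proof (cases "i \<le> j")
  case True
  then have "[i'..j'] = [i'..i - 1] @ [i..j] @ [j + 1..j']"
    using assms upto_split1[of i' i j'] upto_split2[of i j j'] by simp
  then show ?thesis by simp
qed simp

text \<open>Compactness: iterated one-step extensions give nested words that exhaust a bi-infinite
  word.\<close>

lemma extends_forever_factor_of_skeleton:
  assumes "finite S" and "set u \<subseteq> S" and ext: "\<And>n. extends_by G S n u"
  shows "\<exists>x\<in>skeleton G S. factor_of u x"
proof -
  define Q where "Q = (\<lambda>u. set u \<subseteq> S \<and> (\<forall>n. extends_by G S n u))"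
  have "\<exists>v. \<forall>n. (Q (v n) \<and> (n = 0 \<longrightarrow> v n = u)) \<and> (\<exists>a b. v (Suc n) = a # v n @ [b])"
  proof (rule dependent_nat_choice)
    show "\<exists>v. Q v \<and> ((0::nat) = 0 \<longrightarrow> v = u)"
      using assms by (auto simp: Q_def)
    show "\<exists>w. (Q w \<and> (Suc n = 0 \<longrightarrow> w = u)) \<and> (\<exists>a b. w = a # v @ [b])"
      if v: "Q v \<and> (n = 0 \<longrightarrow> v = u)" for v n
    proof -
      obtain a b where "a \<in> S" "b \<in> S" "\<forall>n. extends_by G S n (a # v @ [b])"
        using extends_forever_step[OF \<open>finite S\<close>, of G v] v unfolding Q_def by blast
      then show ?thesis
        using v by (intro exI[of _ "a # v @ [b]"]) (auto simp: Q_def)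
    qed
  qed
  then obtain v where v: "\<And>n. Q (v n)" "v 0 = u" and "\<forall>n. \<exists>a b. v (Suc n) = a # v n @ [b]"
    by metis
  then obtain a b where ab: "\<And>n. v (Suc n) = a n # v n @ [b n]"
    by metis
  define l where "l = int (length u)"
  \<comment> \<open>\<open>u\<close> sits at positions 0 to \<open>l - 1\<close>; the letter added
    on the left in round \<open>n\<close> goes to \<open>- n - 1\<close>, the one on the right to
    \<open>l + n\<close>.\<close>
  define x where "x = (\<lambda>i. if i < 0 then a (nat (- i - 1)) else if i < l then u ! nat i
    else b (nat (i - l)))"
  have vx: "v n = map x [- int n..l + int n - 1]" for n
  proof (induction n)
    case 0
    show ?case
      by (rule nth_equalityI) (auto simp: v x_def l_def nth_upto)
  next
    case (Suc n)
    have "[- int (Suc n)..l + int (Suc n) - 1] =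
        (- int (Suc n)) # [- int n..l + int n - 1] @ [l + int n]"
      using upto_rec1[of "- int (Suc n)" "l + int n"] upto_rec2[of "- int n" "l + int n"]
      by (simp add: l_def)
    then show ?case
      by (simp add: ab Suc.IH x_def) (auto simp: l_def)
  qed
  have sub: "\<exists>n. sublist (map x [i..j]) (v n)" for i j
    unfolding vx
    by (rule exI[of _ "nat \<bar>i\<bar> + nat \<bar>j\<bar> + 1"], rule sublist_map_upto) (auto simp: l_def)
  have free: "loop_free G (v n)" for n
  proof -
    have "extends_by G S 0 (v n)" using v by (auto simp: Q_def)
    then show ?thesis by (auto simp: extends_by_def)
  qed
  have "x i \<in> S" for i
  proof -
    obtain n where "sublist (map x [i..i]) (v n)" using sub by blast
    then have "x i \<in> set (v n)" using set_mono_sublist by fastforce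
    then show ?thesis using v(1)[of n] by (auto simp: Q_def)
  qed
  moreover have "word_value G w \<noteq> \<one>\<^bsub>G\<^esub>" if "factor_of w x" "w \<noteq> []" for w
    using that sub free by (fastforce simp: factor_of_def loop_free_def)
  ultimately have "x \<in> skeleton G S" by (auto simp: skeleton_def)
  moreover have "factor_of u x"
    unfolding factor_of_def using vx[of 0] v(2) by auto
  ultimately show ?thesis by blast
qed

lemma factor_of_iff:
  "factor_of w x \<longleftrightarrow> (\<exists>i. w = map x [i..i + int (length w) - 1])"
proof
  assume "factor_of w x"
  then obtain i j where w: "w = map x [i..j]" by (auto simp: factor_of_def)
  show "\<exists>i. w = map x [i..i + int (length w) - 1]"
  proof (cases "i \<le> j")
    case True
    then show ?thesis using w by (intro exI[of _ i]) simp
  qed (use w in auto)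
qed (auto simp: factor_of_def)

text \<open>A window that stays within one period is a proper factor of the loop. One that wraps
  around is the complement of a factor \<open>m\<close> in a rotation of the loop, so if it were
  trivial, \<open>m\<close> would be trivial too.\<close>

lemma (in group) simple_loop_periodic_loop_free:
  assumes w: "simple_loop G w" "set w \<subseteq> carrier G"
    and v: "0 < l" "l < length w" "v = map (\<lambda>i. w ! nat (i mod int (length w))) [i..i + int l - 1]"
  shows "word_value G v \<noteq> \<one>"
proof -
  define n where "n = length w"
  define k where "k = nat (i mod int n)"
  have n: "n > 0" "l < n" using v by (auto simp: n_def)
  then have k: "k < n" "int k = i mod int n" by (auto simp: k_def nat_less_iff)
  have len: "length v = l" using v by simp
  have nth: "v ! j = w ! ((k + j) mod n)" if "j < l" for j
  proof -
    have "(i + int j) mod int n = (int k + int j) mod int n"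
      using k(2) by (simp add: mod_add_left_eq)
    also have "\<dots> = int ((k + j) mod n)" by (simp add: zmod_int)
    finally show ?thesis using that v(3) by (simp add: nth_upto n_def)
  qed
  have simple: "word_value G u \<noteq> \<one>" if "w = p @ u @ s" "u \<noteq> []" "p \<noteq> [] \<or> s \<noteq> []" for p u s
    using w(1) that unfolding simple_loop_def strict_sublist_iff by blast
  show ?thesis
  proof (cases "k + l \<le> n")
    case True
    have "v = take l (drop k w)"
      by (rule nth_equalityI) (use True n in \<open>auto simp: len nth n_def\<close>)
    then have eq: "w = take k w @ v @ drop (k + l) w"
      by (metis append_take_drop_id drop_drop add.commute)
    have "v \<noteq> []" using len v(1) by auto
    moreover have "take k w \<noteq> [] \<or> drop (k + l) w \<noteq> []"
      using n True k by (auto simp: n_def)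
    ultimately show ?thesis using simple[OF eq] by blast
  next
    case False
    define r where "r = k + l - n"
    have r: "r < k" "k + l = n + r" "r < n" using False n k by (auto simp: r_def)
    have veq: "v = drop k w @ take r w"
    proof (rule nth_equalityI)
      show "length v = length (drop k w @ take r w)"
        using r k by (simp add: len n_def[symmetric])
      fix j assume "j < length v"
      then have j: "j < l" by (simp add: len)
      show "v ! j = (drop k w @ take r w) ! j"
      proof (cases "j < n - k")
        case True
        then show ?thesis using nth[OF j] k by (simp add: nth_append n_def[symmetric])
      next
        case F: False
        then have "(k + j) mod n = k + j - n" "j - (n - k) < r" "k + j - n = j - (n - k)"
          using j r k by (auto simp: mod_if)
        then show ?thesis using nth[OF j] F k by (simp add: nth_append n_def[symmetric])
      qed
    qed
    define m where "m = take (k - r) (drop r w)"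
    have weq: "w = take r w @ m @ drop k w"
      using r(1) unfolding m_def
      by (metis append_take_drop_id drop_drop le_add_diff_inverse2 less_imp_le)
    have c: "set (take r w) \<subseteq> carrier G" "set m \<subseteq> carrier G" "set (drop k w) \<subseteq> carrier G"
      using w(2) unfolding m_def by (meson order_trans set_drop_subset set_take_subset)+
    have m1: "word_value G m \<noteq> \<one>"
      by (rule simple[OF weq]) (use r k in \<open>auto simp: m_def n_def\<close>)
    show ?thesis
    proof
      assume v1: "word_value G v = \<one>"
      have "word_value G (take r w @ (m @ drop k w)) = \<one>"
        using weq w(1) by (simp add: simple_loop_def)
      then have "word_value G ((m @ drop k w) @ take r w) = \<one>"
        using word_value_swap[of "take r w" "m @ drop k w"] c by simp
      then have "word_value G (m @ v) = \<one>" by (simp add: veq)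
      then show False using v1 m1 c by (simp add: word_value_append veq)
    qed
  qed
qed

lemma (in group) simple_loops_bounded_if_SFT:
  assumes S: "finite S" "S \<subseteq> carrier G" and sft: "SFT S (skeleton G S)"
  shows "\<exists>N. \<forall>w. simple_loop G w \<and> set w \<subseteq> S \<longrightarrow> length w \<le> N"
proof -
  obtain F where F: "finite F" "F \<subseteq> lists S" "skeleton G S = avoiding_shift S F"
    using sft by (auto simp: SFT_def)
  let ?B = "{u \<in> F. \<exists>n. \<not> extends_by G S n u}"
  have "\<forall>u\<in>?B. \<exists>n. \<not> extends_by G S n u" by blast
  from bchoice[OF this] obtain f where f: "\<forall>u\<in>?B. \<not> extends_by G S (f u) u" ..
  \<comment> \<open>\<open>M\<close> is a margin at which every word of \<open>F\<close> that cannot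
    be extended forever has already failed to extend.\<close>
  define M where "M = Max (insert 0 (f ` ?B))"
  define L where "L = Max (insert 0 (length ` F))"
  have M: "f u \<le> M" if "u \<in> ?B" for u
    unfolding M_def using F(1) that by (intro Max_ge) auto
  have L: "length u \<le> L" if "u \<in> F" for u
    unfolding L_def using F(1) that by (intro Max_ge) auto
  \<comment> \<open>A forbidden word with a margin \<open>M\<close> on both sides has length at most
    \<open>L + 2 * M\<close>; in a longer loop such a window is shorter than the period and hence
    contains no loop.\<close>
  have "length w \<le> L + 2 * M" if w: "simple_loop G w" "set w \<subseteq> S" for w
  proof (rule ccontr)
    assume long: "\<not> length w \<le> L + 2 * M"
    define n where "n = length w"
    define y where "y = (\<lambda>i. w ! nat (i mod int n))"
    have n: "n > L + 2 * M" using long by (simp add: n_def)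
    have yS: "y i \<in> S" for i
    proof -
      have "nat (i mod int n) < n" using n by (simp add: nat_less_iff)
      then show ?thesis using w(2) nth_mem unfolding y_def n_def by blast
    qed
    have free: "loop_free G (map y [i..j])" if "j - i + 1 < int n" for i j
      unfolding loop_free_def
    proof (intro allI impI)
      fix v assume v: "sublist v (map y [i..j]) \<and> v \<noteq> []"
      have "factor_of v y"
        using v factor_of_sublist[of "map y [i..j]" y v] by (auto simp: factor_of_def)
      then obtain i' where "v = map y [i'..i' + int (length v) - 1]"
        by (auto simp: factor_of_iff)
      moreover have "length v < length w" "0 < length v"
        using v sublist_length_le[of v "map y [i..j]"] that n n_def by auto
      ultimately show "word_value G v \<noteq> \<one>"
        using simple_loop_periodic_loop_free[OF w(1), of "length v" v i'] w(2) S(2)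
        by (auto simp: y_def n_def)
    qed
    have "\<not> factor_of u y" if u: "u \<in> F" for u
    proof
      assume "factor_of u y"
      then obtain i where i: "u = map y [i..i + int (length u) - 1]" by (auto simp: factor_of_iff)
      have "extends_by G S M u"
      proof -
        let ?k = "i + int (length u) - 1"
        let ?x = "map y [i - int M..i - 1]" and ?y = "map y [?k + 1..?k + int M]"
        have "?x @ u @ ?y = map y [i - int M..?k + int M]"
        proof -
          have "[i - int M..?k + int M] = [i - int M..i - 1] @ [i..?k + int M]"
            by (rule upto_append) auto
          moreover have "[i..?k + int M] = [i..?k] @ [?k + 1..?k + int M]"
            using upto_append[of i "?k + 1" "?k + int M"] by simp
          ultimately show ?thesis by (subst i) simp
        qed
        moreover have "loop_free G (map y [i - int M..?k + int M])"
          by (rule free) (use n L[OF u] in linarith)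
        ultimately have "loop_free G (?x @ u @ ?y)" by metis
        then show ?thesis
          unfolding extends_by_def
          by (intro exI[of _ ?x] exI[of _ ?y]) (use yS in auto)
      qed
      \<comment> \<open>By the choice of \<open>M\<close>, a word of \<open>F\<close> that extends
        by \<open>M\<close> extends forever.\<close>
      then have "extends_by G S n u" for n
        using f M[of u] u extends_by_mono[of G S M u "f u"] by blast
      then obtain x where "x \<in> skeleton G S" "factor_of u x"
        using extends_forever_factor_of_skeleton[OF S(1)] F(2) u by blast
      then show False using F(3) u by (auto simp: avoiding_shift_def)
    qed
    then have "y \<in> skeleton G S" using F(3) yS by (auto simp: avoiding_shift_def)
    moreover have "w = map y [0..int n - 1]"
      by (rule nth_equalityI) (auto simp: n_def y_def nth_upto)
    then have "factor_of w y" by (auto simp: factor_of_def)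
    ultimately show False using w(1) by (auto simp: skeleton_def simple_loop_def)
  qed
  then show ?thesis by blast
qed


section \<open>Inseparable vertices of a graph\<close>

text \<open>By reflexivity \<open>z\<close> also reaches itself, which is why a path avoiding
  \<open>z\<close> is only extracted when \<open>x \<noteq> z\<close>.\<close>

definition reach_avoiding :: "('v \<Rightarrow> 'v \<Rightarrow> bool) \<Rightarrow> 'v \<Rightarrow> 'v \<Rightarrow> 'v \<Rightarrow> bool" where
  "reach_avoiding E z = (\<lambda>x y. E x y \<and> x \<noteq> z \<and> y \<noteq> z)\<^sup>*\<^sup>*"

text \<open>This relation is not transitive in general: the midpoint of a path with two edges
  separates its ends.\<close>

definition inseparable :: "('v \<Rightarrow> 'v \<Rightarrow> bool) \<Rightarrow> 'v \<Rightarrow> 'v \<Rightarrow> bool" where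
  "inseparable E x y \<longleftrightarrow> (\<forall>z. z \<noteq> x \<and> z \<noteq> y \<longrightarrow> reach_avoiding E z x y)"

definition cycle :: "('v \<Rightarrow> 'v \<Rightarrow> bool) \<Rightarrow> 'v list \<Rightarrow> bool" where
  "cycle E vs \<longleftrightarrow> distinct vs \<and> 2 \<le> length vs \<and> successively E vs \<and> E (last vs) (hd vs)"

lemma reach_avoiding_refl [simp]: "reach_avoiding E z x x"
  by (simp add: reach_avoiding_def)

lemma reach_avoiding_trans:
  "reach_avoiding E z x y \<Longrightarrow> reach_avoiding E z y w \<Longrightarrow> reach_avoiding E z x w"
  unfolding reach_avoiding_def by (rule rtranclp_trans)

lemma reach_avoiding_edge: "E x y \<Longrightarrow> x \<noteq> z \<Longrightarrow> y \<noteq> z \<Longrightarrow> reach_avoiding E z x y"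
  unfolding reach_avoiding_def by (rule r_into_rtranclp) auto

lemma inseparable_refl [simp]: "inseparable E x x"
  by (simp add: inseparable_def)

lemma inseparable_edge: "E x y \<Longrightarrow> inseparable E x y"
  by (auto simp: inseparable_def intro: reach_avoiding_edge)

text \<open>Whatever single vertex other than \<open>u\<close> and \<open>v\<close> is removed, one
  of \<open>x\<close> and \<open>y\<close> remains to connect them.\<close>

lemma inseparable_common_pair:
  assumes "inseparable E u x" "inseparable E u y" "inseparable E x v" "inseparable E y v" "x \<noteq> y"
  shows "inseparable E u v"
  using assms unfolding inseparable_def by (metis reach_avoiding_trans)

lemma successively_rev_sym:
  assumes "\<And>x y. E x y \<Longrightarrow> E y x"
  shows "successively E (rev vs) \<longleftrightarrow> successively E vs"
proof -
  have "successively (\<lambda>x y. E y x) vs = successively E vs"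
    using assms by (intro successively_cong) auto
  then show ?thesis by (simp only: successively_rev)
qed

lemma reach_avoiding_successively:
  assumes "successively E vs" "vs \<noteq> []" "z \<notin> set vs"
  shows "reach_avoiding E z (hd vs) (last vs)"
  using assms
proof (induction vs rule: induct_list012)
  case (3 x y zs)
  then have "reach_avoiding E z x y" by (auto intro: reach_avoiding_edge)
  then show ?case using 3 by (auto intro: reach_avoiding_trans)
qed auto

lemma reach_avoiding_path:
  assumes "reach_avoiding E z x y" "x \<noteq> z"
  obtains vs where "successively E vs" "vs \<noteq> []" "hd vs = x" "last vs = y" "z \<notin> set vs"
proof -
  have "\<exists>vs. successively E vs \<and> vs \<noteq> [] \<and> hd vs = x \<and> last vs = y \<and> z \<notin> set vs"
    using assms unfolding reach_avoiding_def
  proof (induction rule: rtranclp_induct)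
    case base
    then show ?case by (intro exI[of _ "[x]"]) auto
  next
    case (step y w)
    then obtain vs where vs: "successively E vs" "vs \<noteq> []" "hd vs = x" "last vs = y" "z \<notin> set vs"
      by auto
    then show ?case
      using step by (intro exI[of _ "vs @ [w]"]) (auto simp: successively_append_iff)
  qed
  then show ?thesis using that by blast
qed

lemma successively_distinct_path:
  assumes "successively E vs" "vs \<noteq> []"
  obtains us where "successively E us" "us \<noteq> []" "hd us = hd vs" "last us = last vs" "distinct us"
    "set us \<subseteq> set vs"
proof -
  have "\<exists>us. successively E us \<and> us \<noteq> [] \<and> hd us = hd vs \<and> last us = last vs \<and> distinct us
      \<and> set us \<subseteq> set vs"
    using assms
  proof (induction "length vs" arbitrary: vs rule: less_induct)
    case less
    show ?case
    proof (cases "distinct vs")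
      case False
      then obtain xs ys zs y where vs: "vs = xs @ [y] @ ys @ [y] @ zs"
        using not_distinct_decomp by blast
      let ?us = "xs @ [y] @ zs"
      have "successively E ?us"
        using less.prems(1) vs by (auto simp: successively_append_iff successively_Cons)
      moreover have "length ?us < length vs" "?us \<noteq> []" using vs by auto
      ultimately obtain us where "successively E us" "us \<noteq> []" "hd us = hd ?us"
          "last us = last ?us" "distinct us" "set us \<subseteq> set ?us"
        using less.hyps[of ?us] by blast
      moreover have "hd ?us = hd vs" using vs by (cases xs) auto
      moreover have "last ?us = last vs" "set ?us \<subseteq> set vs" using vs by auto
      ultimately show ?thesis by (intro exI[of _ us]) auto
    qed (use less.prems in blast)
  qed
  then show ?thesis using that by blast
qed

lemma cycle_rotate:
  assumes "cycle E (us @ vs)"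
  shows "cycle E (vs @ us)"
  using assms by (cases "us = []"; cases "vs = []") (auto simp: cycle_def successively_append_iff)

lemma cycle_rev:
  assumes "cycle E vs" "\<And>x y. E x y \<Longrightarrow> E y x"
  shows "cycle E (rev vs)"
proof -
  have "vs \<noteq> []" using assms(1) by (auto simp: cycle_def)
  then show ?thesis
    using assms successively_rev_sym[of E vs]
    by (auto simp: cycle_def hd_rev last_rev simp del: successively_rev)
qed

text \<open>Removing \<open>y\<close> leaves the given path to \<open>y'\<close>; after any other
  removal \<open>y'\<close> is reached through \<open>y\<close>.\<close>

lemma inseparable_before_end:
  assumes sym: "\<And>x y. E x y \<Longrightarrow> E y x"
    and p: "successively E (x # p @ [y', y])" "distinct (x # p @ [y', y])"
    and xy: "inseparable E x y"
  shows "inseparable E x y'"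
  unfolding inseparable_def
proof (intro allI impI)
  fix z assume z: "z \<noteq> x \<and> z \<noteq> y'"
  show "reach_avoiding E z x y'"
  proof (cases "z = y")
    case True
    then show ?thesis
      using reach_avoiding_successively[of E "x # p @ [y']" z] p
      by (auto simp: successively_append_iff successively_Cons hd_append split: if_splits)
  next
    case False
    then have "reach_avoiding E z x y" using xy z by (auto simp: inseparable_def)
    moreover have "E y y'" using p(1) sym by (auto simp: successively_append_iff successively_Cons)
    then have "reach_avoiding E z y y'" using False z by (auto intro: reach_avoiding_edge)
    ultimately show ?thesis by (rule reach_avoiding_trans)
  qed
qed

text \<open>Whitney's argument, by induction along a path from \<open>x\<close> to \<open>y\<close>.
  A cycle through \<open>x\<close> and the predecessor \<open>y'\<close> of \<open>y\<close> is
  rerouted through \<open>y\<close> with the help of a second path from \<open>x\<close> to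
  \<open>y\<close> that avoids \<open>y'\<close>.\<close>

lemma inseparable_common_cycle:
  assumes sym: "\<And>x y. E x y \<Longrightarrow> E y x"
  shows "successively E (x # p @ [y]) \<Longrightarrow> distinct (x # p @ [y]) \<Longrightarrow> inseparable E x y \<Longrightarrow>
    \<exists>vs. cycle E vs \<and> x \<in> set vs \<and> y \<in> set vs"
proof (induction p arbitrary: y rule: rev_induct)
  case Nil
  then have "cycle E [x, y]" using sym by (auto simp: cycle_def)
  then show ?case by (intro exI[of _ "[x, y]"]) auto
next
  case (snoc y' p)
  have path: "successively E (x # p @ [y', y])" "distinct (x # p @ [y', y])"
    using snoc.prems by simp_all
  have insep: "inseparable E x y'"
    by (rule inseparable_before_end[OF sym path snoc.prems(3)])
  have edge: "E y' y" and ne: "x \<noteq> y'" "y \<noteq> y'" "x \<noteq> y"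
    using path by (auto simp: successively_append_iff successively_Cons)
  obtain vs where vs: "cycle E vs" "x \<in> set vs" "y' \<in> set vs"
    using snoc.IH[OF _ _ insep] path
    by (auto simp: successively_append_iff successively_Cons hd_append split: if_splits)
  show ?case
  proof (cases "y \<in> set vs")
    case False
    obtain vs1 vs2 where "vs = vs1 @ y' # vs2" using vs(3) by (meson split_list)
    then have cyc: "cycle E (y' # vs2 @ vs1)"
      using cycle_rotate[of E vs1 "y' # vs2"] vs(1) by simp
    define A where "A = vs2 @ vs1"
    have A: "cycle E (y' # A)" "x \<in> set A" "y \<notin> set A"
      using cyc vs(2) False ne \<open>vs = _\<close> by (auto simp: A_def)
    have "reach_avoiding E y' x y" using snoc.prems(3) ne by (auto simp: inseparable_def)
    then obtain Q0 where Q0: "successively E Q0" "Q0 \<noteq> []" "hd Q0 = x" "last Q0 = y" "y' \<notin> set Q0"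
      using ne(1) by (rule reach_avoiding_path)
    obtain Q where Q: "successively E Q" "Q \<noteq> []" "hd Q = x" "last Q = y" "y' \<notin> set Q" "distinct Q"
      by (rule successively_distinct_path[OF Q0(1,2)]) (use Q0 in auto)
    \<comment> \<open>\<open>q\<close> is the last vertex of the second path on the cycle, so the
      remainder \<open>R\<close> does not meet the cycle.\<close>
    have "\<exists>q\<in>set Q. q \<in> set A" using A(2) Q(2,3) hd_in_set by blast
    from split_list_last_prop[OF this] obtain Q1 q R
      where R: "Q = Q1 @ q # R" "q \<in> set A" "\<forall>r\<in>set R. r \<notin> set A"
      by (elim exE conjE)
    have "R \<noteq> []" using R Q(4) A(3) by auto
    then have R': "successively E (q # R)" "last R = y" "distinct R" "y' \<notin> set R"
      using Q R(1) by (auto simp: successively_append_iff)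
    text \<open>The path \<open>R\<close> closes up the arc of the cycle from \<open>y'\<close> to \<open>q\<close> that contains \<open>x\<close>.\<close>
    have close: "\<exists>vs. cycle E vs \<and> x \<in> set vs \<and> y \<in> set vs"
      if B: "cycle E (y' # B1 @ q # B2)" "set (B1 @ q # B2) = set A" "x \<in> set B1 \<union> {q}"
      for B1 B2
    proof -
      have "cycle E (y' # B1 @ q # R)"
        unfolding cycle_def
      proof (intro conjI)
        have "distinct (y' # B1 @ q # B2)" using B(1) by (simp add: cycle_def)
        moreover have "set R \<inter> set (B1 @ [q]) = {}" using R(3) B(2) by auto
        ultimately show "distinct (y' # B1 @ q # R)" using R' by auto
        have "successively E ((y' # B1) @ q # B2)" using B(1) by (simp add: cycle_def)
        then have "successively E ((y' # B1) @ q # R)"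
          using R'(1) by (simp only: successively_append_iff list.sel) simp
        then show "successively E (y' # B1 @ q # R)" by simp
        show "E (last (y' # B1 @ q # R)) (hd (y' # B1 @ q # R))"
          using R'(2) \<open>R \<noteq> []\<close> sym[OF edge] by simp
      qed simp
      moreover have "y \<in> set R" using R'(2) \<open>R \<noteq> []\<close> last_in_set by blast
      ultimately show ?thesis
        using B(3) by (intro exI[of _ "y' # B1 @ q # R"]) auto
    qed
    obtain A1 A2 where A12: "A = A1 @ q # A2" using R(2) by (meson split_list)
    show ?thesis
    proof (cases "x \<in> set A1 \<union> {q}")
      case True
      then show ?thesis using close[of A1 A2] A(1) A12 by auto
    next
      \<comment> \<open>If \<open>x\<close> lies on the other arc, the cycle is traversed
        backwards.\<close>
      case F: False
      have "cycle E (rev A2 @ q # rev A1 @ [y'])"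
        using cycle_rev[OF A(1) sym] A12 by simp
      then have "cycle E (y' # rev A2 @ q # rev A1)"
        using cycle_rotate[of E "rev A2 @ q # rev A1" "[y']"] by simp
      then show ?thesis
        using close[of "rev A2" "rev A1"] A12 A(2) F by auto
    qed
  qed (use vs in blast)
qed


section \<open>Cayley graphs with bounded simple loops\<close>

locale cayley = group G for G :: "('a, 'b) monoid_scheme" (structure) +
  fixes S :: "'a set" and N :: nat
  assumes S: "generating_set G S"
    and bounded: "simple_loop G w \<Longrightarrow> set w \<subseteq> S \<Longrightarrow> length w \<le> N"
begin

definition adj :: "'a \<Rightarrow> 'a \<Rightarrow> bool" where
  "adj x y \<longleftrightarrow> x \<in> carrier G \<and> y \<in> carrier G \<and> inv x \<otimes> y \<in> S"

definition insep :: "'a set" where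
  "insep = {g \<in> carrier G. inseparable adj \<one> g}"

lemma S_carrier: "S \<subseteq> carrier G" and finite_S: "finite S"
  using S by (auto simp: generating_set_def)

lemma inv_S: "s \<in> S \<Longrightarrow> inv s \<in> S"
  using S unfolding generating_set_def by blast

section \<open>Symmetry and translation invariance of the Cayley graph\<close>

lemma adj_sym: "adj x y \<Longrightarrow> adj y x"
  unfolding adj_def using inv_S[of "inv x \<otimes> y"] by (auto simp: inv_mult_group)

lemma adj_translate:
  assumes "g \<in> carrier G" "adj x y"
  shows "adj (g \<otimes> x) (g \<otimes> y)"
proof -
  have "inv (g \<otimes> x) \<otimes> (g \<otimes> y) = inv x \<otimes> y"
    using assms by (simp add: adj_def inv_mult_group m_assoc inv_solve_left')
  then show ?thesis using assms by (simp add: adj_def)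
qed

lemma reach_avoiding_translate:
  assumes "g \<in> carrier G" "x \<in> carrier G" "z \<in> carrier G" "reach_avoiding adj z x y"
  shows "reach_avoiding adj (g \<otimes> z) (g \<otimes> x) (g \<otimes> y)"
  using assms(4) unfolding reach_avoiding_def
proof (induction rule: rtranclp_induct)
  case (step y w)
  have c: "y \<in> carrier G" "w \<in> carrier G" using step(2) by (auto simp: adj_def)
  have "adj (g \<otimes> y) (g \<otimes> w)" using adj_translate[OF assms(1)] step(2) by blast
  then show ?case
    by (intro rtranclp.rtrancl_into_rtrancl[OF step(3)]) (use step(2) c assms in auto)
qed simp

lemma inseparable_translate:
  assumes "g \<in> carrier G" "x \<in> carrier G" "y \<in> carrier G" "inseparable adj x y"
  shows "inseparable adj (g \<otimes> x) (g \<otimes> y)"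
  unfolding inseparable_def
proof (intro allI impI)
  fix z assume z: "z \<noteq> g \<otimes> x \<and> z \<noteq> g \<otimes> y"
  show "reach_avoiding adj z (g \<otimes> x) (g \<otimes> y)"
  proof (cases "z \<in> carrier G")
    case True
    let ?z = "inv g \<otimes> z"
    have eq: "g \<otimes> ?z = z" using True assms(1) by (simp add: m_assoc[symmetric])
    have "?z \<noteq> x" "?z \<noteq> y" using z eq by auto
    then have "reach_avoiding adj ?z x y" using assms(4) by (auto simp: inseparable_def)
    then show ?thesis
      using reach_avoiding_translate[of g x ?z y] True assms eq by simp
  next
    case False
    \<comment> \<open>Vertices range over the whole type. One outside the group cannot be
      translated, but it also meets no edge and obstructs nothing.\<close>
    then have "z \<noteq> x" "z \<noteq> y" using assms by auto
    then have "reach_avoiding adj z x y"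
      using assms(4) unfolding inseparable_def by blast
    then show ?thesis
      unfolding reach_avoiding_def
    proof (induction rule: rtranclp_induct)
      case (step y w)
      have "adj (g \<otimes> y) (g \<otimes> w)" using adj_translate[OF assms(1)] step(2) by blast
      then show ?case
        using False by (intro rtranclp.rtrancl_into_rtrancl[OF step(3)]) (auto simp: adj_def)
    qed simp
  qed
qed

lemma inv_mult_mem_insep:
  assumes "x \<in> carrier G" "y \<in> carrier G"
  shows "inv x \<otimes> y \<in> insep \<longleftrightarrow> inseparable adj x y"
proof -
  have "x \<otimes> (inv x \<otimes> y) = y" using assms by (simp add: m_assoc[symmetric])
  then show ?thesis
    using inseparable_translate[of "inv x" x y] inseparable_translate[of x \<one> "inv x \<otimes> y"] assms
    by (auto simp: insep_def)
qed

lemma reach_avoiding_sym: "reach_avoiding adj z x y \<Longrightarrow> reach_avoiding adj z y x"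
proof -
  have "symp (\<lambda>x y. adj x y \<and> x \<noteq> z \<and> y \<noteq> z)" using adj_sym by (auto simp: symp_def)
  then show "reach_avoiding adj z x y \<Longrightarrow> reach_avoiding adj z y x"
    unfolding reach_avoiding_def by (meson sympD symp_rtranclp)
qed

lemma inseparable_sym: "inseparable adj x y \<Longrightarrow> inseparable adj y x"
  using reach_avoiding_sym by (auto simp: inseparable_def)

lemma insep_carrier: "insep \<subseteq> carrier G"
  by (auto simp: insep_def)

lemma S_insep: "S \<subseteq> insep"
  using S_carrier by (auto simp: insep_def adj_def intro!: inseparable_edge)

text \<open>\<open>\<one>\<close> and \<open>a \<otimes> b \<otimes> c\<close> are both inseparable
  from \<open>a\<close> and from \<open>a \<otimes> b\<close>, which differ because
  \<open>b \<noteq> \<one>\<close>.\<close>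

lemma insep_triple:
  assumes "a \<in> insep" "b \<in> insep" "c \<in> insep" "b \<noteq> \<one>" "a \<otimes> b \<in> insep" "b \<otimes> c \<in> insep"
  shows "a \<otimes> b \<otimes> c \<in> insep"
proof -
  have c: "a \<in> carrier G" "b \<in> carrier G" "c \<in> carrier G"
    using assms insep_carrier by auto
  have 1: "inseparable adj \<one> a" "inseparable adj \<one> (a \<otimes> b)" using assms by (auto simp: insep_def)
  have "inseparable adj (a \<otimes> \<one>) (a \<otimes> (b \<otimes> c))"
    by (rule inseparable_translate) (use assms c in \<open>auto simp: insep_def\<close>)
  moreover have "inseparable adj (a \<otimes> b \<otimes> \<one>) (a \<otimes> b \<otimes> c)"
    by (rule inseparable_translate) (use assms c in \<open>auto simp: insep_def\<close>)
  ultimately have "inseparable adj \<one> (a \<otimes> b \<otimes> c)"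
    using inseparable_common_pair[OF 1, of "a \<otimes> b \<otimes> c"] c assms(4) by (auto simp: m_assoc)
  then show ?thesis using c by (auto simp: insep_def)
qed

section \<open>Paths of vertices and words of edge labels\<close>

lemma successively_word_path:
  assumes "set w \<subseteq> S" "x \<in> carrier G"
  shows "\<exists>vs. successively adj vs \<and> vs \<noteq> [] \<and> hd vs = x \<and> last vs = x \<otimes> word_value G w"
  using assms
proof (induction w arbitrary: x)
  case Nil
  then show ?case by (intro exI[of _ "[x]"]) auto
next
  case (Cons s w)
  have s: "s \<in> carrier G" "set w \<subseteq> carrier G" using Cons.prems S_carrier by auto
  then obtain vs where vs: "successively adj vs" "vs \<noteq> []" "hd vs = x \<otimes> s"
      "last vs = x \<otimes> s \<otimes> word_value G w"
    using Cons.IH[of "x \<otimes> s"] Cons.prems by auto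
  have "adj x (x \<otimes> s)" using s Cons.prems by (simp add: adj_def m_assoc[symmetric])
  then show ?case
    using vs s Cons.prems by (intro exI[of _ "x # vs"]) (auto simp: successively_Cons m_assoc)
qed

lemma path_from_one:
  assumes "g \<in> carrier G"
  obtains vs where "successively adj vs" "vs \<noteq> []" "hd vs = \<one>" "last vs = g" "distinct vs"
proof -
  have "m_inv G ` S \<subseteq> S" using inv_S by blast
  then obtain w where w: "w \<in> lists S" "g = word_value G w"
    using generate_eq_word_values[OF S_carrier] assms S unfolding generating_set_def by blast
  moreover from this have "set w \<subseteq> carrier G" using S_carrier by auto
  ultimately obtain vs where "successively adj vs" "vs \<noteq> []" "hd vs = \<one>" "last vs = g"
    using successively_word_path[of w \<one>] by auto
  then show ?thesis using successively_distinct_path[of adj vs] that by metis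
qed

definition steps :: "'a list \<Rightarrow> 'a list" where
  "steps vs = map (\<lambda>i. inv (vs ! i) \<otimes> vs ! Suc i) [0..<length vs - 1]"

lemma steps_Cons [simp]: "steps (x # y # vs) = (inv x \<otimes> y) # steps (y # vs)"
  by (simp add: steps_def upt_conv_Cons map_Suc_upt[symmetric] del: upt_Suc)

lemma steps_Nil [simp]: "steps [] = []" and steps_single [simp]: "steps [x] = []"
  by (simp_all add: steps_def)

text \<open>The product of the edge labels telescopes.\<close>

lemma word_value_steps:
  "vs \<noteq> [] \<Longrightarrow> set vs \<subseteq> carrier G \<Longrightarrow> word_value G (steps vs) = inv (hd vs) \<otimes> last vs"
proof (induction vs rule: induct_list012)
  case (3 x y zs)
  have c: "x \<in> carrier G" "y \<in> carrier G" "set (y # zs) \<subseteq> carrier G" using 3(4) by auto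
  have l: "last (y # zs) \<in> carrier G" using c(3) last_in_set[of "y # zs"] by blast
  have "word_value G (steps (y # zs)) = inv y \<otimes> last (y # zs)" using 3(2)[OF _ c(3)] by simp
  then have "word_value G (steps (x # y # zs)) = inv x \<otimes> y \<otimes> (inv y \<otimes> last (y # zs))"
    by simp
  also have "\<dots> = inv x \<otimes> last (y # zs)"
    using c l by (metis inv_closed l_inv m_assoc r_inv r_one m_closed)
  finally show ?case by simp
qed auto

lemma steps_S: "successively adj vs \<Longrightarrow> set (steps vs) \<subseteq> S"
  by (induction vs rule: induct_list012) (auto simp: adj_def)

lemma successively_adj_carrier: "successively adj vs \<Longrightarrow> 2 \<le> length vs \<Longrightarrow> set vs \<subseteq> carrier G"
proof (induction vs rule: induct_list012)
  case (3 x y zs)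
  then show ?case by (cases zs) (auto simp: adj_def)
qed auto

text \<open>A factor of \<open>n\<close> labels spans \<open>n + 1\<close> consecutive vertices; for
  the empty factor there might be no vertex at all, whence \<open>v \<noteq> []\<close>.\<close>

lemma sublist_steps:
  assumes "sublist v (steps vs)" "v \<noteq> []"
  obtains p us s where "vs = p @ us @ s" "v = steps us" "length us = Suc (length v)"
proof -
  obtain a b where ab: "steps vs = a @ v @ b" using assms(1) by (auto simp: sublist_def)
  have len: "length vs - 1 = length a + length v + length b"
    using arg_cong[OF ab, of length] by (simp add: steps_def)
  let ?us = "take (Suc (length v)) (drop (length a) vs)"
  have us: "length ?us = Suc (length v)" using len assms(2) by (cases v) auto
  have "v = steps ?us"
  proof (rule nth_equalityI)
    show "length v = length (steps ?us)" using us by (simp add: steps_def)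
    fix i assume i: "i < length v"
    have "v ! i = steps vs ! (length a + i)" using ab i by (simp add: nth_append)
    also have "\<dots> = steps ?us ! i" using i len us by (simp add: steps_def)
    finally show "v ! i = steps ?us ! i" .
  qed
  moreover have "vs = take (length a) vs @ ?us @ drop (Suc (length v)) (drop (length a) vs)"
    by (metis append_take_drop_id)
  ultimately show ?thesis using that us by blast
qed

text \<open>The edge labels of a cycle form a simple loop: a trivial proper factor would make two
  vertices of the cycle coincide.\<close>

lemma cycle_length:
  assumes "cycle adj vs"
  shows "length vs \<le> N"
proof -
  let ?vs = "vs @ [hd vs]"
  let ?w = "steps ?vs"
  have vs: "distinct vs" "2 \<le> length vs" "vs \<noteq> []" and succ: "successively adj ?vs"
    using assms by (auto simp: cycle_def successively_append_iff)
  have c: "set ?vs \<subseteq> carrier G" by (rule successively_adj_carrier[OF succ]) (use vs in auto)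
  have "simple_loop G ?w"
    unfolding simple_loop_def
  proof (intro conjI allI impI)
    show "?w \<noteq> []" using vs by (auto simp: steps_def)
    have "hd vs \<in> carrier G" using c by simp
    then show "word_value G ?w = \<one>" using word_value_steps[OF _ c] vs by simp
    fix v assume v: "strict_sublist v ?w \<and> v \<noteq> []"
    then obtain p us s where us: "?vs = p @ us @ s" "v = steps us" "length us = Suc (length v)"
      using sublist_steps[of v ?vs] by (auto simp: strict_sublist_def)
    have len: "length v < length ?w" "length ?w = length vs"
      using v strict_sublist_length by blast (simp add: steps_def)
    have usc: "set us \<subseteq> carrier G" using us(1) c by (metis le_supE set_append)
    have us2: "us \<noteq> []" "us = hd us # tl us" "last us = last (tl us)" "tl us \<noteq> []"
      using us(3) v by (cases us; auto)+
    have "hd us \<noteq> last us"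
    \<comment> \<open>Closing the cycle repeats its first vertex at the end, so a factor that
      reaches the end is treated separately; being proper, it omits the start.\<close>
    proof (cases "s = []")
      case False
      then have "vs = p @ us @ butlast s" using us(1) by (metis append_assoc butlast_append butlast_snoc)
      then have "distinct us" using vs(1) by auto
      then show ?thesis using us2 by (metis distinct.simps(2) last_in_set)
    next
      case True
      then have "p \<noteq> []" using us len arg_cong[OF us(1), of length] by auto
      have vs': "vs = p @ butlast us"
        using us(1) True us2(1) by (metis append_Nil2 butlast_append butlast_snoc)
      then have "hd vs \<in> set p" using \<open>p \<noteq> []\<close> by (cases p) auto
      moreover have "hd vs = last us"
        using arg_cong[OF us(1), of last] True us2(1) by simp
      moreover have "hd us \<in> set (butlast us)"
        using us2 by (metis butlast.simps(2) list.set_intros(1))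
      ultimately show ?thesis using vs(1) vs' by auto
    qed
    moreover have "hd us \<in> carrier G" "last us \<in> carrier G"
      using usc us2(1) by auto
    ultimately show "word_value G v \<noteq> \<one>"
      using word_value_steps[OF us2(1) usc] us(2) by (simp add: inv_mult_eq_one_iff)
  qed
  moreover have "set ?w \<subseteq> S" using steps_S[OF succ] .
  ultimately show ?thesis using bounded[of ?w] by (simp add: steps_def)
qed

text \<open>For \<open>g \<noteq> \<one>\<close>, an arc from \<open>\<one>\<close> to
  \<open>g\<close> on a common cycle has fewer than \<open>N\<close> edges, and its labels spell
  \<open>g\<close>.\<close>

lemma finite_insep: "finite insep"
proof -
  let ?W = "{w. set w \<subseteq> S \<and> length w \<le> N}"
  have "insep \<subseteq> word_value G ` ?W"
  proof
    fix g assume g: "g \<in> insep"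
    then have gc: "g \<in> carrier G" by (simp add: insep_def)
    show "g \<in> word_value G ` ?W"
    proof (cases "g = \<one>")
      case True
      then show ?thesis by (intro image_eqI[of _ _ "[]"]) auto
    next
      case False
      obtain vs where vs: "successively adj vs" "vs \<noteq> []" "hd vs = \<one>" "last vs = g" "distinct vs"
        using path_from_one[OF gc] .
      then obtain p where "vs = \<one> # p @ [g]"
        using False by (metis append_butlast_last_id hd_Cons_tl last.simps)
      then obtain us where us: "cycle adj us" "\<one> \<in> set us" "g \<in> set us"
        using inseparable_common_cycle[of adj \<one> p g] adj_sym vs g by (auto simp: insep_def)
      obtain u1 u2 where "us = u1 @ \<one> # u2" using us(2) by (meson split_list)
      then have cyc: "cycle adj (\<one> # u2 @ u1)" using cycle_rotate[of adj u1 "\<one> # u2"] us(1) by simp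
      moreover have "g \<in> set (u2 @ u1)" using us(3) False \<open>us = _\<close> by auto
      then obtain x y where xy: "u2 @ u1 = x @ g # y" by (meson split_list)
      ultimately have succ: "successively adj (\<one> # x @ [g])" and len: "length x + 2 \<le> N"
        using cycle_length[of "\<one> # u2 @ u1"]
        by (auto simp: cycle_def successively_append_iff successively_Cons hd_append
            split: if_splits)
      have "set (\<one> # x @ [g]) \<subseteq> carrier G"
        using successively_adj_carrier[OF succ] by auto
      then have "word_value G (steps (\<one> # x @ [g])) = g"
        using word_value_steps[of "\<one> # x @ [g]"] gc by simp
      moreover have "steps (\<one> # x @ [g]) \<in> ?W"
        using steps_S[OF succ] len by (simp add: steps_def)
      ultimately show ?thesis by (metis image_eqI)
    qed
  qed
  moreover have "finite ?W" using finite_S by (rule finite_lists_length_le)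
  ultimately show ?thesis by (meson finite_surj)
qed

text \<open>Two consecutive steps of a simple loop are bridged by the rest of the loop, which avoids
  the middle vertex.\<close>
lemma insep_reduced:
  assumes w: "set w \<subseteq> insep - {\<one>}" "w \<noteq> []" "word_value G w = \<one>"
  shows "\<not> successively (\<lambda>a b. a \<otimes> b \<notin> insep) w"
proof
  assume red: "successively (\<lambda>a b. a \<otimes> b \<notin> insep) w"
  \<comment> \<open>The loop may be taken simple, so that it does not come back to the vertex
    \<open>a\<close>.\<close>
  obtain v where v: "sublist v w" "simple_loop G v" using simple_loop_sublist[OF w(2,3)] by blast
  have setv: "set v \<subseteq> insep - {\<one>}" using set_mono_sublist[OF v(1)] w(1) by blast
  have redv: "successively (\<lambda>a b. a \<otimes> b \<notin> insep) v"
    using v(1) red by (auto simp: sublist_def successively_append_iff)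
  have "v \<noteq> []" "word_value G v = \<one>" using v(2) by (auto simp: simple_loop_def)
  moreover have "v \<noteq> [a]" for a using \<open>word_value G v = \<one>\<close> setv insep_carrier by auto
  ultimately obtain a b r where vab: "v = a # b # r" by (metis neq_Nil_conv)
  have ab: "a \<in> carrier G" "b \<in> carrier G" "set r \<subseteq> carrier G" "a \<in> insep" "b \<in> insep"
    "set r \<subseteq> insep" "b \<noteq> \<one>" "a \<noteq> \<one>"
    using setv vab insep_carrier by auto
  have reach: "reach_avoiding adj a (a \<otimes> b \<otimes> word_value G p) (a \<otimes> b \<otimes> word_value G (p @ q))"
    if "r = p @ q @ s" for p q s
    using that
  proof (induction q arbitrary: p)
    case (Cons c q)
    let ?g = "a \<otimes> b \<otimes> word_value G p"
    have pc: "set p \<subseteq> carrier G" "c \<in> carrier G" "c \<in> insep" using ab Cons.prems by auto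
    \<comment> \<open>A return to the vertex \<open>a\<close> would make the factor
      \<open>b # p'\<close> trivial.\<close>
    have ne: "word_value G (b # p') \<noteq> \<one>" if "r = p' @ s'" for p' s'
      using v(2) vab that unfolding simple_loop_def strict_sublist_iff
      by (metis append_Cons append_Nil list.distinct(1))
    have 1: "a \<noteq> ?g" "a \<noteq> ?g \<otimes> c"
      using ne[of p "c # q @ s"] ne[of "p @ [c]" "q @ s"] ab pc Cons.prems
      by (auto simp: m_assoc word_value_append)
    have "inseparable adj (?g \<otimes> \<one>) (?g \<otimes> c)"
      by (rule inseparable_translate) (use ab pc in \<open>auto simp: insep_def\<close>)
    then have "reach_avoiding adj a ?g (?g \<otimes> c)"
      using 1 ab pc by (auto simp: inseparable_def)
    moreover have "reach_avoiding adj a (a \<otimes> b \<otimes> word_value G (p @ [c]))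
        (a \<otimes> b \<otimes> word_value G ((p @ [c]) @ q))"
      by (rule Cons.IH) (use Cons.prems in simp)
    ultimately show ?case
      using reach_avoiding_trans pc ab by (fastforce simp: word_value_append m_assoc)
  qed simp
  have "a \<otimes> b \<otimes> word_value G r = \<one>"
    using \<open>word_value G v = \<one>\<close> vab ab by (simp add: m_assoc)
  then have long_way: "reach_avoiding adj a (a \<otimes> b) \<one>"
    using reach[of "[]" r "[]"] ab by simp
  have "inseparable adj \<one> (a \<otimes> b)"
    unfolding inseparable_def
  proof (intro allI impI)
    fix z assume z: "z \<noteq> \<one> \<and> z \<noteq> a \<otimes> b"
    show "reach_avoiding adj z \<one> (a \<otimes> b)"
    proof (cases "z = a")
      case True
      then show ?thesis using long_way reach_avoiding_sym by blast
    next
      case False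
      have "inseparable adj (a \<otimes> \<one>) (a \<otimes> b)"
        by (rule inseparable_translate) (use ab in \<open>auto simp: insep_def\<close>)
      then have "reach_avoiding adj z a (a \<otimes> b)" "reach_avoiding adj z \<one> a"
        using z False ab by (auto simp: inseparable_def insep_def)
      then show ?thesis using reach_avoiding_trans by metis
    qed
  qed
  then have "a \<otimes> b \<in> insep" using ab by (auto simp: insep_def)
  then show False using redv vab by auto
qed

lemma block_set_insep: "block_set G insep"
proof
  show "finite insep" by (rule finite_insep)
  show "insep \<subseteq> carrier G" by (rule insep_carrier)
  show "\<one> \<in> insep" by (simp add: insep_def)
  show "inv a \<in> insep" if "a \<in> insep" for a
    using that inv_mult_mem_insep[of a \<one>] inseparable_sym by (auto simp: insep_def)
  have "carrier G \<subseteq> generate G insep"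
    using S mono_generate[OF S_insep] by (simp add: generating_set_def)
  then show "generate G insep = carrier G"
    using generate_incl[OF insep_carrier] by blast
  show "a \<otimes> b \<otimes> c \<in> insep"
    if "a \<in> insep" "b \<in> insep" "c \<in> insep" "b \<noteq> \<one>" "a \<otimes> b \<in> insep" "b \<otimes> c \<in> insep" for a b c
    using insep_triple that .
  show "word_value G w \<noteq> \<one>"
    if "set w \<subseteq> insep - {\<one>}" "w \<noteq> []" "successively (\<lambda>a b. a \<otimes> b \<notin> insep) w" for w
    using insep_reduced that by blast
qed

end


section \<open>Universal properties of free products and free groups\<close>

text \<open>Built with \<open>fp_cons\<close> and not as a one-syllable word, so that the identity
  of a factor becomes the empty word.\<close>

definition fp_embed :: "('i \<Rightarrow> 'a monoid) \<Rightarrow> 'i \<Rightarrow> 'a \<Rightarrow> ('i \<times> 'a) list" where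
  "fp_embed F i g = fp_cons F (i, g) []"

definition fp_lift :: "('c, 'd) monoid_scheme \<Rightarrow> ('i \<Rightarrow> 'a \<Rightarrow> 'c) \<Rightarrow> ('i \<times> 'a) list \<Rightarrow> 'c" where
  "fp_lift L f w = word_value L (map (\<lambda>(i, g). f i g) w)"

definition fg_lift :: "('c, 'd) monoid_scheme \<Rightarrow> (nat \<Rightarrow> 'c) \<Rightarrow> (nat \<times> bool) list \<Rightarrow> 'c" where
  "fg_lift L t w = word_value L (map (\<lambda>(i, b). if b then t i else inv\<^bsub>L\<^esub> t i) w)"

locale factors =
  fixes I :: "'i set" and F :: "'i \<Rightarrow> 'a monoid"
  assumes group_factor: "i \<in> I \<Longrightarrow> group (F i)"
begin

abbreviation "FP \<equiv> free_product I F"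

lemma group_FP: "group FP"
  by (rule group_free_product) (rule group_factor)

lemma carrier_FP: "carrier FP = fp_words I F" and one_FP: "\<one>\<^bsub>FP\<^esub> = []"
  by (simp_all add: free_product_def)

lemma fp_embed_closed: "i \<in> I \<Longrightarrow> g \<in> carrier (F i) \<Longrightarrow> fp_embed F i g \<in> carrier FP"
  unfolding fp_embed_def carrier_FP
  by (rule fp_cons_closed[OF group_factor]) (auto intro: fp_words_Nil)

lemma fp_embed_mult:
  assumes "i \<in> I" "g \<in> carrier (F i)" "w \<in> fp_words I F"
  shows "fp_embed F i g \<otimes>\<^bsub>FP\<^esub> w = fp_cons F (i, g) w"
  using fp_mult_cons[OF group_factor assms(1,2) fp_words_Nil assms(3)]
  by (simp add: fp_embed_def free_product_def)

lemma fp_embed_hom: "i \<in> I \<Longrightarrow> fp_embed F i \<in> hom (F i) FP"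
proof (rule homI)
  fix g h assume i: "i \<in> I" and gh: "g \<in> carrier (F i)" "h \<in> carrier (F i)"
  show "fp_embed F i (g \<otimes>\<^bsub>F i\<^esub> h) = fp_embed F i g \<otimes>\<^bsub>FP\<^esub> fp_embed F i h"
    using fp_embed_mult[OF i gh(1), of "fp_embed F i h"] fp_embed_closed[OF i gh(2)]
      fp_cons_cons[where I = I and G = F, OF group_factor i gh fp_words_Nil]
    by (simp add: carrier_FP) (simp add: fp_embed_def)
qed (rule fp_embed_closed)

lemma Cons_eq_fp_embed_mult:
  assumes "(i, g) # w \<in> fp_words I F"
  shows "(i, g) # w = fp_embed F i g \<otimes>\<^bsub>FP\<^esub> w"
  using assms fp_embed_mult[of i g w] fp_cons_eq_Cons[OF assms] by (auto simp: fp_words_Cons)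

lemma FP_hom_unique:
  assumes "group L" and hom: "\<phi> \<in> hom FP L" "\<chi> \<in> hom FP L"
    and eq: "\<And>i g. i \<in> I \<Longrightarrow> g \<in> carrier (F i) \<Longrightarrow> \<phi> (fp_embed F i g) = \<chi> (fp_embed F i g)"
    and w: "w \<in> carrier FP"
  shows "\<phi> w = \<chi> w"
  using w unfolding carrier_FP
proof (induction w)
  case Nil
  show ?case
    using hom_one[OF hom(1) group_FP \<open>group L\<close>] hom_one[OF hom(2) group_FP \<open>group L\<close>]
    by (simp add: one_FP)
next
  case (Cons p w)
  obtain i g where p: "p = (i, g)" by (cases p)
  have ig: "i \<in> I" "g \<in> carrier (F i)" "w \<in> fp_words I F"
    using Cons.prems p by (auto simp: fp_words_Cons)
  then show ?case
    using Cons.IH Cons_eq_fp_embed_mult[of i g w] Cons.prems p eq[OF ig(1,2)]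
      hom_mult[OF hom(1) fp_embed_closed[OF ig(1,2)], of w]
      hom_mult[OF hom(2) fp_embed_closed[OF ig(1,2)], of w]
    by (simp add: carrier_FP)
qed

context
  fixes L :: "('c, 'd) monoid_scheme" and f :: "'i \<Rightarrow> 'a \<Rightarrow> 'c"
  assumes L: "group L" and f: "\<And>i. i \<in> I \<Longrightarrow> f i \<in> hom (F i) L"
begin

lemma fp_lift_closed: "w \<in> fp_words I F \<Longrightarrow> fp_lift L f w \<in> carrier L"
proof -
  interpret L: group L by (rule L)
  assume "w \<in> fp_words I F"
  then have "set (map (\<lambda>(i, g). f i g) w) \<subseteq> carrier L"
    using f by (fastforce simp: fp_words_def hom_def)
  then show ?thesis unfolding fp_lift_def by (rule L.word_value_closed)
qed

text \<open>Reduction merges two syllables of the same factor, where \<open>f i\<close> is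
  multiplicative. As products of words are iterated \<open>fp_cons\<close>, this is what makes the
  lift a homomorphism.\<close>

lemma fp_lift_cons:
  assumes i: "i \<in> I" and g: "g \<in> carrier (F i)" and w: "w \<in> fp_words I F"
  shows "fp_lift L f (fp_cons F (i, g) w) = f i g \<otimes>\<^bsub>L\<^esub> fp_lift L f w"
proof -
  interpret L: group L by (rule L)
  interpret Fi: group "F i" using group_factor i .
  interpret fi: group_hom "F i" L "f i"
    by unfold_locales (rule f[OF i])
  have c: "f i g \<in> carrier L" using g by simp
  have wc: "fp_lift L f w \<in> carrier L" by (rule fp_lift_closed[OF w])
  show ?thesis
  proof (cases "w = [] \<or> fst (hd w) \<noteq> i")
    case True
    then have "fp_cons F (i, g) w = (if g = \<one>\<^bsub>F i\<^esub> then w else (i, g) # w)"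
      by (cases w) (auto simp: fp_cons_def)
    then show ?thesis using c wc by (simp add: fp_lift_def)
  next
    case False
    then obtain h v where v: "w = (i, h) # v" by (cases w) auto
    have h: "h \<in> carrier (F i)" "v \<in> fp_words I F" using w v by (auto simp: fp_words_Cons)
    have vc: "fp_lift L f v \<in> carrier L" by (rule fp_lift_closed[OF h(2)])
    have "fp_lift L f w = f i h \<otimes>\<^bsub>L\<^esub> fp_lift L f v" by (simp add: fp_lift_def v)
    then have eq: "f i g \<otimes>\<^bsub>L\<^esub> fp_lift L f w = f i (g \<otimes>\<^bsub>F i\<^esub> h) \<otimes>\<^bsub>L\<^esub> fp_lift L f v"
      using g h vc by (simp add: L.m_assoc)
    show ?thesis
    proof (cases "g = \<one>\<^bsub>F i\<^esub>")
      case True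
      then show ?thesis using wc by (simp add: fp_cons_def)
    next
      case g1: False
      have "fp_cons F (i, g) w =
          (if g \<otimes>\<^bsub>F i\<^esub> h = \<one>\<^bsub>F i\<^esub> then v else (i, g \<otimes>\<^bsub>F i\<^esub> h) # v)"
        using g1 v by (simp add: fp_cons_def)
      then show ?thesis using eq vc by (auto simp: fp_lift_def)
    qed
  qed
qed

lemma fp_lift_embed:
  assumes "i \<in> I" "g \<in> carrier (F i)"
  shows "fp_lift L f (fp_embed F i g) = f i g"
proof -
  interpret L: group L by (rule L)
  have "f i g \<in> carrier L" using f assms by (auto simp: hom_def)
  then show ?thesis
    using fp_lift_cons[OF assms fp_words_Nil] by (simp add: fp_embed_def) (simp add: fp_lift_def)
qed

lemma fp_lift_hom: "fp_lift L f \<in> hom FP L"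
proof (rule homI)
  interpret L: group L by (rule L)
  show "fp_lift L f w \<in> carrier L" if "w \<in> carrier FP" for w
    using that fp_lift_closed by (simp add: carrier_FP)
  fix u v assume uv: "u \<in> carrier FP" "v \<in> carrier FP"
  have v: "v \<in> fp_words I F" using uv by (simp add: carrier_FP)
  have "fp_lift L f (foldr (fp_cons F) u v) = fp_lift L f u \<otimes>\<^bsub>L\<^esub> fp_lift L f v"
    if "u \<in> fp_words I F"
    using that
  proof (induction u)
    case Nil
    then show ?case using fp_lift_closed[OF v] by (simp add: fp_lift_def)
  next
    case (Cons p u)
    obtain i g where p: "p = (i, g)" by (cases p)
    have ig: "i \<in> I" "g \<in> carrier (F i)" "u \<in> fp_words I F"
      using Cons.prems p by (auto simp: fp_words_Cons)
    have "f i g \<in> carrier L" using f[OF ig(1)] ig(2) by (auto simp: hom_def)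
    moreover have "foldr (fp_cons F) u v \<in> fp_words I F"
      by (rule fp_mult_closed[OF group_factor ig(3) v])
    moreover have "fp_lift L f (p # u) = f i g \<otimes>\<^bsub>L\<^esub> fp_lift L f u"
      by (simp add: fp_lift_def p)
    ultimately show ?case
      using Cons.IH[OF ig(3)] fp_lift_cons[OF ig(1,2)] fp_lift_closed[OF ig(3)] fp_lift_closed[OF v]
      by (simp add: p L.m_assoc)
  qed
  then show "fp_lift L f (u \<otimes>\<^bsub>FP\<^esub> v) = fp_lift L f u \<otimes>\<^bsub>L\<^esub> fp_lift L f v"
    using uv by (simp add: carrier_FP) (simp add: free_product_def)
qed

end

end

section \<open>Homomorphisms out of a free group\<close>

context group
begin

lemma fg_lift_closed:
  assumes "\<And>i. i < m \<Longrightarrow> t i \<in> carrier G" "w \<in> fg_words m"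
  shows "fg_lift G t w \<in> carrier G"
  unfolding fg_lift_def using assms by (intro word_value_closed) (auto simp: fg_words_def)

text \<open>A cancelling pair of letters is sent to mutually inverse elements.\<close>

lemma fg_lift_cons:
  assumes t: "\<And>i. i < m \<Longrightarrow> t i \<in> carrier G" and "i < m" "w \<in> fg_words m"
  shows "fg_lift G t (fg_cons (i, b) w) = (if b then t i else inv t i) \<otimes> fg_lift G t w"
proof (cases "w = [] \<or> hd w \<noteq> letter_inv (i, b)")
  case True
  then show ?thesis by (cases w) (auto simp: fg_cons_def fg_lift_def)
next
  case False
  then obtain v where v: "w = (i, \<not> b) # v" by (cases w) (auto simp: letter_inv_def)
  have "v \<in> fg_words m" using assms(3) v by (simp add: fg_words_Cons)
  then have "fg_lift G t v \<in> carrier G" "t i \<in> carrier G" using fg_lift_closed t assms(2) by auto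
  moreover have "fg_cons (i, b) w = v" by (simp add: fg_cons_def v letter_inv_def)
  moreover have "fg_lift G t w = (if b then inv t i else t i) \<otimes> fg_lift G t v"
    by (simp add: fg_lift_def v)
  ultimately show ?thesis by (auto simp: m_assoc[symmetric])
qed

lemma fg_lift_hom:
  assumes t: "\<And>i. i < m \<Longrightarrow> t i \<in> carrier G"
  shows "fg_lift G t \<in> hom (free_group m) G"
proof (rule homI)
  show "fg_lift G t w \<in> carrier G" if "w \<in> carrier (free_group m)" for w
    using that fg_lift_closed[of m t] t by (simp add: free_group_def)
  fix u v assume "u \<in> carrier (free_group m)" "v \<in> carrier (free_group m)"
  then have uv: "u \<in> fg_words m" "v \<in> fg_words m" by (simp_all add: free_group_def)
  have "fg_lift G t (foldr fg_cons u v) = fg_lift G t u \<otimes> fg_lift G t v"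
    using uv(1)
  proof (induction u)
    case Nil
    then show ?case using fg_lift_closed[of m t v] t uv(2) by (simp add: fg_lift_def)
  next
    case (Cons s u)
    obtain i b where s: "s = (i, b)" by (cases s)
    have i: "i < m" "u \<in> fg_words m" using Cons.prems s by (auto simp: fg_words_Cons)
    have c: "t i \<in> carrier G" "fg_lift G t u \<in> carrier G" "fg_lift G t v \<in> carrier G"
      using t i uv fg_lift_closed[of m t] by auto
    have "fg_lift G t (s # u) = (if b then t i else inv t i) \<otimes> fg_lift G t u"
      by (simp add: fg_lift_def s)
    then show ?case
      using Cons.IH[OF i(2)] fg_lift_cons[of m t i "foldr fg_cons u v" b, OF t i(1)]
        fg_mult_closed[OF i(2) uv(2)] c
      by (simp add: s m_assoc)
  qed
  then show "fg_lift G t (u \<otimes>\<^bsub>free_group m\<^esub> v) = fg_lift G t u \<otimes> fg_lift G t v"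
    by (simp add: free_group_def)
qed

text \<open>The image of an inverse letter is forced by that of the positive one, and the letters
  generate.\<close>

lemma free_group_hom_unique:
  assumes hom: "\<phi> \<in> hom (free_group m) G" "\<chi> \<in> hom (free_group m) G"
    and eq: "\<And>i. i < m \<Longrightarrow> \<phi> [(i, True)] = \<chi> [(i, True)]"
    and w: "w \<in> carrier (free_group m)"
  shows "\<phi> w = \<chi> w"
proof -
  interpret F: group "free_group m" by (rule group_free_group)
  interpret phi: group_hom "free_group m" G \<phi> by unfold_locales (rule hom)
  interpret chi: group_hom "free_group m" G \<chi> by unfold_locales (rule hom)
  have car: "carrier (free_group m) = fg_words m" "\<one>\<^bsub>free_group m\<^esub> = []"
    by (simp_all add: free_group_def)
  have letter: "\<phi> [(i, b)] = \<chi> [(i, b)]" if "i < m" for i b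
  proof (cases b)
    case False
    have c: "[(i, b)] \<in> carrier (free_group m)" for b
      using that by (simp add: car fg_words_Cons fg_words_Nil)
    have "[(i, False)] \<otimes>\<^bsub>free_group m\<^esub> [(i, True)] = \<one>\<^bsub>free_group m\<^esub>"
      by (simp add: free_group_def fg_cons_def letter_inv_def)
    then have "[(i, False)] = inv\<^bsub>free_group m\<^esub> [(i, True)]"
      using c F.inv_equality by metis
    then show ?thesis using False eq[OF that] c by simp
  qed (use eq[OF that] in simp)
  have "w \<in> fg_words m \<Longrightarrow> \<phi> w = \<chi> w"
  proof (induction w)
    case Nil
    then show ?case using phi.hom_one chi.hom_one by (simp add: car)
  next
    case (Cons s w)
    obtain i b where s: "s = (i, b)" by (cases s)
    have i: "i < m" "w \<in> fg_words m" using Cons.prems s by (auto simp: fg_words_Cons)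
    have c: "[s] \<in> carrier (free_group m)" "w \<in> carrier (free_group m)"
      using i s by (auto simp: car fg_words_Cons fg_words_Nil)
    have "s # w = [s] \<otimes>\<^bsub>free_group m\<^esub> w"
      using Cons.prems by (cases w) (auto simp: free_group_def fg_cons_def fg_words_Cons)
    then show ?case
      using Cons.IH[OF i(2)] letter[OF i(1), of b] c s by (simp del: One_nat_def)
  qed
  then show ?thesis using w car by simp
qed

lemma word_value_map_inv_rev:
  "set w \<subseteq> carrier G \<Longrightarrow> word_value G (map (m_inv G) (rev w)) = inv (word_value G w)"
proof (induction w)
  case (Cons a w)
  have "set (map (m_inv G) (rev w)) \<subseteq> carrier G" "set [inv a] \<subseteq> carrier G" using Cons.prems by auto
  from word_value_append[OF this] show ?case using Cons by (simp add: inv_mult_group)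
qed simp

end

section \<open>The groupoid of a block set\<close>

context block_set
begin

lemma word_in_P:
  assumes "g \<in> carrier G"
  obtains w where "set w \<subseteq> P - {\<one>}" "word_value G w = g"
proof -
  have "generate G (P - {\<one>}) = word_value G ` lists (P - {\<one>})"
    by (rule generate_eq_word_values) (use inv_P in auto)
  then have "g \<in> word_value G ` lists (P - {\<one>})"
    using generating_set_P assms by (simp add: generating_set_def)
  then obtain w where "w \<in> lists (P - {\<one>})" "g = word_value G w" ..
  then show ?thesis using that[of w] by auto
qed

text \<open>By \<open>reduced\<close> every nonempty loop over \<open>P\<close> has a pair of
  adjacent letters that can be merged, and merging keeps the value in \<open>L\<close> because
  \<open>F\<close> respects that product. So every relation is a consequence of the partial
  multiplication.\<close>

lemma partial_hom_loop:
  assumes "group L" and F: "\<And>a. a \<in> P \<Longrightarrow> F a \<in> carrier L" "F \<one> = \<one>\<^bsub>L\<^esub>"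
    and mult: "\<And>a b. a \<in> P \<Longrightarrow> b \<in> P \<Longrightarrow> a \<otimes> b \<in> P \<Longrightarrow> F (a \<otimes> b) = F a \<otimes>\<^bsub>L\<^esub> F b"
  shows "set w \<subseteq> P - {\<one>} \<Longrightarrow> word_value G w = \<one> \<Longrightarrow> word_value L (map F w) = \<one>\<^bsub>L\<^esub>"
proof (induction "length w" arbitrary: w rule: less_induct)
  case less
  interpret L: group L by fact
  show ?case
  proof (cases "w = []")
    case False
    then obtain u a b v where w: "w = u @ a # b # v" "a \<otimes> b \<in> P"
      using loop_reducible[OF less.prems(1) _ less.prems(2)] by blast
    have mem: "a \<in> P" "b \<in> P" "set u \<subseteq> P - {\<one>}" "set v \<subseteq> P - {\<one>}" using less.prems w by auto
    have c: "set u \<subseteq> carrier G" "set v \<subseteq> carrier G" using mem by auto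
    have Lc: "set (map F u) \<subseteq> carrier L" "set (map F v) \<subseteq> carrier L" "F a \<in> carrier L"
      "F b \<in> carrier L"
      using mem F(1) by auto
    \<comment> \<open>A pair with trivial product is deleted, since words range over
      \<open>P - {\<one>}\<close>; this is where \<open>F \<one>\<close> has to be trivial.\<close>
    let ?w = "u @ (if a \<otimes> b = \<one> then [] else [a \<otimes> b]) @ v"
    have "word_value G ?w = word_value G u \<otimes> (a \<otimes> b \<otimes> word_value G v)"
      using c mem by (simp add: word_value_append)
    also have "\<dots> = word_value G w"
      using c mem by (simp add: w(1) word_value_append m_assoc)
    finally have "word_value L (map F ?w) = \<one>\<^bsub>L\<^esub>"
      using less.hyps[of ?w] less.prems w mem by auto
    moreover have "word_value L (map F ?w) =
        word_value L (map F u) \<otimes>\<^bsub>L\<^esub> (F (a \<otimes> b) \<otimes>\<^bsub>L\<^esub> word_value L (map F v))"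
      using Lc F w(2) by (auto simp: L.word_value_append[OF Lc(1)] simp del: set_map)
    moreover have "\<dots> = word_value L (map F w)"
      using Lc by (simp add: w(1) L.word_value_append[OF Lc(1)] L.m_assoc mult[OF mem(1,2) w(2)]
          del: set_map)
    ultimately show ?thesis by simp
  qed simp
qed

text \<open>\<open>G\<close> is presented by the partial multiplication of \<open>P\<close>.\<close>
lemma partial_hom_extends:
  assumes L: "group L" and F: "\<And>a. a \<in> P \<Longrightarrow> F a \<in> carrier L" "F \<one> = \<one>\<^bsub>L\<^esub>"
    and mult: "\<And>a b. a \<in> P \<Longrightarrow> b \<in> P \<Longrightarrow> a \<otimes> b \<in> P \<Longrightarrow> F (a \<otimes> b) = F a \<otimes>\<^bsub>L\<^esub> F b"
  obtains \<Psi> where "\<Psi> \<in> hom G L" "\<And>a. a \<in> P \<Longrightarrow> \<Psi> a = F a"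
proof -
  interpret L: group L by fact
  have Fc: "set (map F w) \<subseteq> carrier L" if "set w \<subseteq> P - {\<one>}" for w
    using that F(1) by auto
  have Finv: "F (inv a) = inv\<^bsub>L\<^esub> F a" if "a \<in> P" for a
    using mult[of "inv a" a] that inv_P one_P F L.inv_equality[of "F (inv a)" "F a"] by simp
  \<comment> \<open>\<open>u\<close> followed by the formal inverse of \<open>v\<close> is a loop,
    whose image is trivial.\<close>
  have unique: "word_value L (map F u) = word_value L (map F v)"
    if "set u \<subseteq> P - {\<one>}" "set v \<subseteq> P - {\<one>}" "word_value G u = word_value G v" for u v
  proof -
    let ?v = "map (m_inv G) (rev v)"
    have c: "set u \<subseteq> carrier G" "set v \<subseteq> carrier G" "set ?v \<subseteq> carrier G" using that by auto
    have vP: "set ?v \<subseteq> P - {\<one>}" using that inv_P by auto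
    have "map F ?v = map (m_inv L) (rev (map F v))"
      using that(2) Finv by (auto simp: rev_map)
    then have Lv: "word_value L (map F ?v) = inv\<^bsub>L\<^esub> word_value L (map F v)"
      using L.word_value_map_inv_rev[OF Fc[OF that(2)]] by metis
    have "word_value G (u @ ?v) = \<one>"
      using c that(3) by (simp add: word_value_append[OF c(1,3)] word_value_map_inv_rev del: set_map)
    then have "word_value L (map F (u @ ?v)) = \<one>\<^bsub>L\<^esub>"
      using partial_hom_loop[OF L, of F "u @ ?v"] F mult that vP by auto
    then have "word_value L (map F u) \<otimes>\<^bsub>L\<^esub> inv\<^bsub>L\<^esub> word_value L (map F v) = \<one>\<^bsub>L\<^esub>"
      using L.word_value_append[OF Fc[OF that(1)] Fc[OF vP]] Lv by simp
    then show ?thesis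
      using L.word_value_closed[OF Fc[OF that(1)]] L.word_value_closed[OF Fc[OF that(2)]]
      by (metis L.inv_equality L.inv_inv L.inv_closed)
  qed
  \<comment> \<open>Any word for \<open>g\<close> may be chosen, by \<open>unique\<close>.\<close>
  define \<Psi> where "\<Psi> = (\<lambda>g. word_value L (map F (SOME w. set w \<subseteq> P - {\<one>} \<and> word_value G w = g)))"
  have \<Psi>: "\<Psi> (word_value G w) = word_value L (map F w)" if "set w \<subseteq> P - {\<one>}" for w
  proof -
    let ?w = "SOME v. set v \<subseteq> P - {\<one>} \<and> word_value G v = word_value G w"
    have "set ?w \<subseteq> P - {\<one>} \<and> word_value G ?w = word_value G w"
      by (rule someI[of _ w]) (use that in auto)
    then show ?thesis unfolding \<Psi>_def using unique that by blast
  qed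
  have "\<Psi> \<in> hom G L"
  proof (rule homI)
    fix g assume "g \<in> carrier G"
    then obtain w where w: "set w \<subseteq> P - {\<one>}" "word_value G w = g" by (rule word_in_P)
    then show "\<Psi> g \<in> carrier L" using \<Psi>[OF w(1)] L.word_value_closed[OF Fc[OF w(1)]] by simp
  next
    fix g h assume "g \<in> carrier G" "h \<in> carrier G"
    then obtain u v where uv: "set u \<subseteq> P - {\<one>}" "word_value G u = g"
        "set v \<subseteq> P - {\<one>}" "word_value G v = h"
      by (metis word_in_P)
    have "g \<otimes> h = word_value G (u @ v)"
      using uv P_carrier by (subst word_value_append) auto
    then show "\<Psi> (g \<otimes> h) = \<Psi> g \<otimes>\<^bsub>L\<^esub> \<Psi> h"
      using \<Psi>[of "u @ v"] \<Psi>[OF uv(1)] \<Psi>[OF uv(3)] uv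
        L.word_value_append[OF Fc[OF uv(1)] Fc[OF uv(3)]]
      by simp
  qed
  moreover have "\<Psi> a = F a" if "a \<in> P" for a
    using \<Psi>[of "[a]"] \<Psi>[of "[]"] that F by (cases "a = \<one>") auto
  ultimately show ?thesis using that by blast
qed

text \<open>Block sets abstract the union of the blocks of a Cayley graph through the identity; \<open>src a\<close> is
  the block that contains \<open>a\<close>, and \<open>src (inv a)\<close> is that block seen from \<open>a\<close>.\<close>
definition src :: "'a \<Rightarrow> 'a set" where
  "src a = {b \<in> P - {\<one>}. inv a \<otimes> b \<in> P}"

text \<open>\<open>\<one>\<close> serves as the identity arrow of every object at once; every other
  arrow determines its ends. Composition is multiplication in \<open>G\<close>, read from left to
  right.\<close>

definition arrows :: "'a set \<Rightarrow> 'a set \<Rightarrow> 'a set" where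
  "arrows x y = {a \<in> P - {\<one>}. src a = x \<and> src (inv a) = y} \<union> (if x = y then {\<one>} else {})"

definition objects :: "'a set set" where
  "objects = src ` (P - {\<one>})"

text \<open>The choice depends only on the set of objects with an arrow to \<open>x\<close>, hence
  on the component of \<open>x\<close>, and so selects one object in each component.\<close>

definition base :: "'a set \<Rightarrow> 'a set" where
  "base x = (SOME y. arrows y x \<noteq> {})"

text \<open>The links form a star from the base object to the others, a spanning tree of the
  component. The value \<open>\<one>\<close> at the base object makes conjugation by links trivial
  there.\<close>

definition link :: "'a set \<Rightarrow> 'a" where
  "link x = (if base x = x then \<one> else SOME a. a \<in> arrows (base x) x)"

text \<open>An instance of \<open>triple\<close> for \<open>inv a \<otimes> b\<close>,
  \<open>inv b\<close> and \<open>c\<close>, whose overlapping products are \<open>inv a\<close> and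
  \<open>inv b \<otimes> c\<close>.\<close>

lemma src_trans:
  assumes "a \<in> P - {\<one>}" "b \<in> P - {\<one>}" "c \<in> P" "inv a \<otimes> b \<in> P" "inv b \<otimes> c \<in> P"
  shows "inv a \<otimes> c \<in> P"
proof -
  have c: "a \<in> carrier G" "b \<in> carrier G" "c \<in> carrier G" using assms by auto
  have "inv a \<otimes> b \<otimes> inv b \<otimes> c \<in> P"
    by (rule triple) (use assms c inv_P in \<open>auto simp: m_assoc\<close>)
  then show ?thesis using c by (simp add: m_assoc)
qed

lemma src_sym:
  assumes "a \<in> P" "b \<in> P" "inv a \<otimes> b \<in> P"
  shows "inv b \<otimes> a \<in> P"
  using inv_P[OF assms(3)] assms by (simp add: inv_mult_group)

text \<open>\<open>src a\<close> is the class of \<open>a\<close> under an equivalence relation on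
  the non-identity elements of \<open>P\<close>.\<close>

lemma src_eq_iff:
  assumes "a \<in> P - {\<one>}" "b \<in> P - {\<one>}"
  shows "src a = src b \<longleftrightarrow> inv a \<otimes> b \<in> P"
proof
  assume "src a = src b"
  moreover have "b \<in> src b" using assms one_P by (auto simp: src_def)
  ultimately show "inv a \<otimes> b \<in> P" by (auto simp: src_def)
next
  assume "inv a \<otimes> b \<in> P"
  moreover from this have "inv b \<otimes> a \<in> P" using src_sym assms by auto
  ultimately show "src a = src b"
    using src_trans[of a b] src_trans[of b a] assms unfolding src_def by blast
qed

section \<open>Composition of arrows, base objects and links\<close>

lemma arrows_P: "arrows x y \<subseteq> P"
  using one_P by (auto simp: arrows_def)

lemma arrows_one: "\<one> \<in> arrows x x"
  by (simp add: arrows_def)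

lemma arrows_inv: "a \<in> arrows x y \<Longrightarrow> inv a \<in> arrows y x"
  using inv_P by (auto simp: arrows_def split: if_splits)

lemma mem_arrows: "a \<in> P - {\<one>} \<Longrightarrow> a \<in> arrows (src a) (src (inv a))"
  by (simp add: arrows_def)

text \<open>This identifies multiplication that stays inside \<open>P\<close> with composition of
  arrows.\<close>

lemma mult_P_iff:
  assumes "a \<in> P - {\<one>}" "b \<in> P - {\<one>}"
  shows "a \<otimes> b \<in> P \<longleftrightarrow> src (inv a) = src b"
  using src_eq_iff[of "inv a" b] assms inv_P by auto

lemma arrows_mult:
  assumes "a \<in> arrows x y" "b \<in> arrows y z"
  shows "a \<otimes> b \<in> arrows x z"
proof (cases "a = \<one> \<or> b = \<one>")
  case True
  moreover have "a \<in> carrier G" "b \<in> carrier G"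
    using assms arrows_P[of x y] arrows_P[of y z] P_carrier by blast+
  moreover have "x = y" if "a = \<one>" using assms(1) that one_P by (auto simp: arrows_def split: if_splits)
  moreover have "y = z" if "b = \<one>" using assms(2) that one_P by (auto simp: arrows_def split: if_splits)
  ultimately show ?thesis using assms by auto
next
  case False
  then have a: "a \<in> P - {\<one>}" "src a = x" "src (inv a) = y"
    and b: "b \<in> P - {\<one>}" "src b = y" "src (inv b) = z"
    using assms by (auto simp: arrows_def split: if_splits)
  have c: "a \<in> carrier G" "b \<in> carrier G" using a b by auto
  have ab: "a \<otimes> b \<in> P" using mult_P_iff a b by auto
  show ?thesis
  proof (cases "a \<otimes> b = \<one>")
    case True
    then have "a = inv b" using c inv_equality by metis
    then show ?thesis using True a b by (simp add: arrows_def)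
  next
    case False
    \<comment> \<open>So \<open>a \<otimes> b\<close> lies in the class of \<open>a\<close>, and its
      inverse in the class of \<open>inv b\<close>.\<close>
    have "inv (a \<otimes> b) \<otimes> a = inv b" "inv (inv (a \<otimes> b)) \<otimes> inv b = a"
      using c by (simp_all add: inv_mult_group m_assoc)
    then have "src (a \<otimes> b) = src a" "src (inv (a \<otimes> b)) = src (inv b)"
      using src_eq_iff[of "a \<otimes> b" a] src_eq_iff[of "inv (a \<otimes> b)" "inv b"] a b ab False inv_P c
      by auto
    then show ?thesis using a b ab False by (simp add: arrows_def)
  qed
qed

text \<open>Composition with the arrow and with its inverse shows that \<open>x\<close> and
  \<open>y\<close> receive arrows from the same objects, so the choice in \<open>base\<close>
  agrees.\<close>

lemma base_eq:
  assumes "a \<in> arrows x y"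
  shows "base x = base y"
proof -
  have "arrows z x \<noteq> {} \<longleftrightarrow> arrows z y \<noteq> {}" for z
    using arrows_mult[OF _ assms, of _ z] arrows_mult[OF _ arrows_inv[OF assms], of _ z] by blast
  then show ?thesis by (simp add: base_def)
qed

lemma arrows_base: "arrows (base x) x \<noteq> {}"
  unfolding base_def by (rule someI[of _ x]) (use arrows_one in blast)

lemma base_base: "base (base x) = base x"
  using arrows_base[of x] base_eq by blast

lemma link_arrow: "link x \<in> arrows (base x) x"
  using arrows_base[of x] arrows_one[of x] some_in_eq[of "arrows (base x) x"]
  by (simp add: link_def)

lemma base_objects: "x \<in> objects \<Longrightarrow> base x \<in> objects"
proof (cases "base x = x")
  case False
  then show ?thesis
    using link_arrow[of x] by (auto simp: arrows_def objects_def)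
qed simp

lemma src_objects: "a \<in> P - {\<one>} \<Longrightarrow> src a \<in> objects" "a \<in> P - {\<one>} \<Longrightarrow> src (inv a) \<in> objects"
  using inv_P by (auto simp: objects_def)

lemma finite_objects: "finite objects"
  using finite_P by (simp add: objects_def)

lemma conjugate_link:
  assumes "a \<in> arrows x y"
  shows "link x \<otimes> a \<otimes> inv (link y) \<in> arrows (base x) (base x)"
  using arrows_mult[OF arrows_mult[OF link_arrow assms] arrows_inv[OF link_arrow]] base_eq[OF assms]
  by simp

lemma arrow_closed [simp]: "a \<in> arrows x y \<Longrightarrow> a \<in> carrier G"
  using arrows_P[of x y] P_carrier by blast

lemma link_closed [simp]: "link x \<in> carrier G"
  using link_arrow arrow_closed by blast

text \<open>\<open>G\<close> is the free product of the vertex groups of the base objects and of the free group on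
  the links of the other objects.\<close>
lemma block_set_universal:
  assumes L: "group L"
    and h: "\<And>x. x \<in> objects \<Longrightarrow> base x = x \<Longrightarrow> h x \<in> hom (G\<lparr>carrier := arrows x x\<rparr>) L"
    and t: "\<And>x. x \<in> objects \<Longrightarrow> t x \<in> carrier L"
      "\<And>x. x \<in> objects \<Longrightarrow> base x = x \<Longrightarrow> t x = \<one>\<^bsub>L\<^esub>"
  obtains \<Psi> where "\<Psi> \<in> hom G L"
    "\<And>x a. x \<in> objects \<Longrightarrow> base x = x \<Longrightarrow> a \<in> arrows x x \<Longrightarrow> \<Psi> a = h x a"
    "\<And>x. x \<in> objects \<Longrightarrow> \<Psi> (link x) = t x"
proof -
  interpret L: group L by fact
  have hc: "h x a \<in> carrier L" if "x \<in> objects" "base x = x" "a \<in> arrows x x" for x a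
    using h[OF that(1,2)] that(3) by (auto simp: hom_def)
  have hm: "h x (a \<otimes> b) = h x a \<otimes>\<^bsub>L\<^esub> h x b"
    if "x \<in> objects" "base x = x" "a \<in> arrows x x" "b \<in> arrows x x" for x a b
    using h[OF that(1,2)] that(3,4) by (auto simp: hom_def)
  have h1: "h x \<one> = \<one>\<^bsub>L\<^esub>" if "x \<in> objects" "base x = x" for x
    using hm[OF that arrows_one arrows_one] hc[OF that arrows_one] by simp
  \<comment> \<open>An arrow from \<open>x\<close> to \<open>y\<close> is the product of
    \<open>inv (link x)\<close>, a loop at the base object and \<open>link y\<close>, which forces
    this value.\<close>
  define f where "f = (\<lambda>x y a. inv\<^bsub>L\<^esub> t x \<otimes>\<^bsub>L\<^esub> h (base x) (link x \<otimes> a \<otimes> inv (link y)) \<otimes>\<^bsub>L\<^esub> t y)"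
  have core: "h (base x) (link x \<otimes> a \<otimes> inv (link y)) \<in> carrier L"
    if "a \<in> arrows x y" "x \<in> objects" for x y a
    using hc[OF base_objects base_base conjugate_link] that by blast
  have f1: "f x x \<one> = \<one>\<^bsub>L\<^esub>" if "x \<in> objects" for x
    using that t(1) h1[OF base_objects base_base] by (simp add: f_def)
  have fm: "f x z (a \<otimes> b) = f x y a \<otimes>\<^bsub>L\<^esub> f y z b"
    if a: "a \<in> arrows x y" and b: "b \<in> arrows y z" and obj: "x \<in> objects" "y \<in> objects" "z \<in> objects"
    for x y z a b
  proof -
    let ?a = "link x \<otimes> a \<otimes> inv (link y)" and ?b = "link y \<otimes> b \<otimes> inv (link z)"
    have c: "a \<in> carrier G" "b \<in> carrier G" using a b by auto
    have eq: "base x = base y" using base_eq[OF a] .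
    have "inv (link y) \<otimes> (link y \<otimes> (b \<otimes> inv (link z))) = b \<otimes> inv (link z)"
      using c by (simp add: m_assoc[symmetric])
    then have ab: "link x \<otimes> (a \<otimes> b) \<otimes> inv (link z) = ?a \<otimes> ?b"
      using c by (simp add: m_assoc)
    have "?a \<in> arrows (base x) (base x)" "?b \<in> arrows (base x) (base x)"
      using conjugate_link[OF a] conjugate_link[OF b] eq by auto
    then have "h (base x) (?a \<otimes> ?b) = h (base x) ?a \<otimes>\<^bsub>L\<^esub> h (base x) ?b"
      by (rule hm[OF base_objects[OF obj(1)] base_base])
    moreover have "h (base x) ?a \<in> carrier L" "h (base x) ?b \<in> carrier L"
      using core[OF a obj(1)] core[OF b obj(2)] eq by auto
    moreover have "t y \<otimes>\<^bsub>L\<^esub> (inv\<^bsub>L\<^esub> t y \<otimes>\<^bsub>L\<^esub> u) = u" if "u \<in> carrier L" for u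
      using that t(1)[OF obj(2)] by (simp add: L.m_assoc[symmetric])
    ultimately show ?thesis
      using t(1) obj unfolding f_def ab eq by (simp add: L.m_assoc)
  qed
  \<comment> \<open>\<open>\<one>\<close> has no ends of its own; by \<open>f1\<close> its value
    agrees with \<open>f\<close> at every object.\<close>
  define F where "F = (\<lambda>a. if a = \<one> then \<one>\<^bsub>L\<^esub> else f (src a) (src (inv a)) a)"
  have Ff: "F a = f x y a" if "a \<in> arrows x y" "x \<in> objects" for x y a
    using that f1[of x] by (auto simp: F_def arrows_def split: if_splits)
  obtain \<Psi> where \<Psi>: "\<Psi> \<in> hom G L" "\<And>a. a \<in> P \<Longrightarrow> \<Psi> a = F a"
  proof (rule partial_hom_extends[OF L, of F])
    show F1: "F \<one> = \<one>\<^bsub>L\<^esub>" by (simp add: F_def)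
    show Fc: "F a \<in> carrier L" if "a \<in> P" for a
    proof (cases "a = \<one>")
      case False
      then have a: "a \<in> P - {\<one>}" using that by simp
      show ?thesis
        using core[OF mem_arrows[OF a] src_objects(1)[OF a]] t(1) src_objects[OF a] False
        by (simp add: F_def f_def)
    qed (simp add: F_def)
    show "F (a \<otimes> b) = F a \<otimes>\<^bsub>L\<^esub> F b" if ab: "a \<in> P" "b \<in> P" "a \<otimes> b \<in> P" for a b
    proof (cases "a = \<one> \<or> b = \<one>")
      case True
      then show ?thesis using Fc[OF ab(1)] Fc[OF ab(2)] F1 ab(1,2) by auto
    next
      case False
      then have a: "a \<in> P - {\<one>}" and b: "b \<in> P - {\<one>}" using ab by auto
      have eq: "src (inv a) = src b" using mult_P_iff[OF a b] ab by simp
      have arr: "a \<in> arrows (src a) (src b)" "b \<in> arrows (src b) (src (inv b))"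
        using mem_arrows[OF a] mem_arrows[OF b] eq by auto
      show ?thesis
        using fm[OF arr] Ff[OF arr(1)] Ff[OF arr(2)] Ff[OF arrows_mult[OF arr]]
          src_objects[OF a] src_objects[OF b]
        by simp
    qed
  qed blast
  show ?thesis
  proof (rule that[OF \<Psi>(1)])
    fix x a assume x: "x \<in> objects" "base x = x" and a: "a \<in> arrows x x"
    \<comment> \<open>At a base object the conjugating factors in \<open>f\<close> are trivial,
      which leaves \<open>h\<close>.\<close>
    have "link x = \<one>" using x by (simp add: link_def)
    then show "\<Psi> a = h x a"
      using \<Psi>(2)[of a] Ff[OF a x(1)] a arrows_P x t(2)[OF x] hc[OF x a] by (auto simp: f_def)
  next
    fix x assume x: "x \<in> objects"
    have 1: "link (base x) = \<one>" "t (base x) = \<one>\<^bsub>L\<^esub>"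
      using base_base t(2)[OF base_objects[OF x] base_base] by (simp_all add: link_def)
    \<comment> \<open>The loop at the base object that corresponds to \<open>link x\<close> is
      trivial, so only the factor \<open>t x\<close> survives.\<close>
    have "\<Psi> (link x) = f (base x) x (link x)"
      using \<Psi>(2)[of "link x"] Ff[OF link_arrow base_objects[OF x]] link_arrow arrows_P by auto
    then show "\<Psi> (link x) = t x"
      using 1 h1[OF base_objects[OF x] base_base] t(1)[OF x] by (simp add: f_def base_base)
  qed
qed

end


section \<open>Groups with a block set are plain\<close>

text \<open>Moves the vertex groups to the element type that the definition of a plain group
  prescribes for its finite factors.\<close>

lemma group_transport:
  assumes "group G" and J: "inj_on J (carrier G)"
  defines "H \<equiv> \<lparr>carrier = J ` carrier G,
    mult = \<lambda>x y. J (inv_into (carrier G) J x \<otimes>\<^bsub>G\<^esub> inv_into (carrier G) J y), one = J \<one>\<^bsub>G\<^esub>\<rparr>"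
  shows "group H" and "J \<in> hom G H" and "inv_into (carrier G) J \<in> hom H G"
proof -
  interpret group G by fact
  have inv_J: "inv_into (carrier G) J (J a) = a" if "a \<in> carrier G" for a
    using J that by simp
  show "group H"
  proof (rule groupI)
    fix x assume "x \<in> carrier H"
    then obtain a where a: "x = J a" "a \<in> carrier G" by (auto simp: H_def)
    show "\<exists>y\<in>carrier H. y \<otimes>\<^bsub>H\<^esub> x = \<one>\<^bsub>H\<^esub>"
      by (rule bexI[of _ "J (inv\<^bsub>G\<^esub> a)"]) (use a inv_J in \<open>auto simp: H_def\<close>)
  qed (auto simp: H_def inv_J m_assoc)
  show "J \<in> hom G H" "inv_into (carrier G) J \<in> hom H G"
    by (auto simp: hom_def H_def inv_J)
qed

context block_set
begin

lemma group_vertex_group: "group (G\<lparr>carrier := arrows x x\<rparr>)"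
proof -
  have "subgroup (arrows x x) G"
  proof (rule subgroupI)
    show "arrows x x \<noteq> {}" using arrows_one by blast
  qed (use arrows_P P_carrier in \<open>auto intro: arrows_inv arrows_mult\<close>)
  then show ?thesis by (rule subgroup.subgroup_is_group) (rule group_axioms)
qed

text \<open>The universal properties of \<open>G\<close> and of the free product give homomorphisms
  in both directions. They are mutually inverse because both composites fix generators, so no normal
  form in \<open>G\<close> is involved.\<close>

lemma plain_group: "plain_group G"
proof -
  \<comment> \<open>There is one finite factor for each component, represented by its base object,
    and one free generator for each remaining object.\<close>
  define R where "R = {x \<in> objects. base x = x}"
  define Q where "Q = {x \<in> objects. base x \<noteq> x}"
  define k where "k = card R"
  define m where "m = card Q"
  have "finite R" "finite Q" using finite_objects by (auto simp: R_def Q_def)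
  then obtain e q where "bij_betw e {0..<k} R" "bij_betw q {0..<m} Q"
    unfolding k_def m_def using ex_bij_betw_nat_finite by meson
  then have e: "bij_betw e {..<k} R" and q: "bij_betw q {..<m} Q"
    by (simp_all add: atLeast0LessThan)
  define e' where "e' = inv_into {..<k} e"
  define q' where "q' = inv_into {..<m} q"
  have eR: "e i \<in> R" and e'e: "e' (e i) = i" if "i < k" for i
    using e that by (auto simp: e'_def bij_betw_def)
  have e'k: "e' x < k" and ee': "e (e' x) = x" if "x \<in> R" for x
    using e that bij_betw_inv_into_right[OF e] inv_into_into[of x e "{..<k}"]
    by (auto simp: e'_def bij_betw_def)
  have qQ: "q i \<in> Q" and q'q: "q' (q i) = i" if "i < m" for i
    using q that by (auto simp: q'_def bij_betw_def)
  have q'm: "q' x < m" and qq': "q (q' x) = x" if "x \<in> Q" for x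
    using q that bij_betw_inv_into_right[OF q] inv_into_into[of x q "{..<m}"]
    by (auto simp: q'_def bij_betw_def)
  obtain c :: "'a \<Rightarrow> nat" where c: "inj_on c P"
    using finite_imp_inj_to_nat_seg[OF finite_P] by blast
  \<comment> \<open>Only injectivity matters: these lists name the elements of the finite factors
    and are not read as elements of the free group.\<close>
  define J where "J = (\<lambda>a. replicate (c a) (0::nat, True))"
  have J: "inj_on J P" using c by (auto simp: J_def inj_on_def)
  have Jx: "inj_on J (arrows x x)" for x
    using J arrows_P inj_on_subset by blast
  define V where "V = (\<lambda>x. G\<lparr>carrier := arrows x x\<rparr>)"
  define J' where "J' = (\<lambda>x. inv_into (arrows x x) J)"
  have J'J: "J' x (J a) = a" if "a \<in> arrows x x" for x a
    using Jx[of x] that by (simp add: J'_def)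
  define H where "H = (\<lambda>i. \<lparr>carrier = J ` carrier (V (e i)),
    mult = \<lambda>x y. J (inv_into (carrier (V (e i))) J x \<otimes>\<^bsub>V (e i)\<^esub> inv_into (carrier (V (e i))) J y),
    one = J \<one>\<^bsub>V (e i)\<^esub>\<rparr>)"
  have V: "group (V x)" "inj_on J (carrier (V x))" for x
    using group_vertex_group Jx by (auto simp: V_def)
  have H: "group (H i)" "J \<in> hom (V (e i)) (H i)" "J' (e i) \<in> hom (H i) (V (e i))" for i
    using group_transport[OF V] by (simp_all add: H_def J'_def V_def)
  have H_carrier: "carrier (H i) = J ` arrows (e i) (e i)" for i
    by (simp add: H_def V_def)
  define F where "F = H(k := free_group m)"
  have Fi: "F i = H i" if "i < k" for i using that by (simp add: F_def)
  have Fk: "F k = free_group m" by (simp add: F_def)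
  interpret FP: factors "{..k}" F
    by (rule factors.intro) (simp add: F_def H group_free_group)
  let ?K = "free_product {..k} F"
  interpret K: group ?K by (rule FP.group_FP)
  define h where "h = (\<lambda>x a. fp_embed F (e' x) (J a))"
  define t where "t = (\<lambda>x. if base x = x then \<one>\<^bsub>?K\<^esub> else fp_embed F k [(q' x, True)])"
  have letter: "[(i, True)] \<in> carrier (F k)" if "i < m" for i
    using that by (simp add: Fk free_group_def fg_words_Cons fg_words_Nil)
  have embed_k: "fp_embed F k \<in> hom (free_group m) ?K"
    using FP.fp_embed_hom[of k] by (simp add: Fk)
  have hom_h: "h x \<in> hom (G\<lparr>carrier := arrows x x\<rparr>) ?K" if "x \<in> objects" "base x = x" for x
  proof -
    have x: "x \<in> R" using that by (simp add: R_def)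
    have "J \<in> hom (V x) (F (e' x))"
      using H(2)[of "e' x"] Fi[OF e'k[OF x]] ee'[OF x] by simp
    moreover have "fp_embed F (e' x) \<in> hom (F (e' x)) ?K"
      using FP.fp_embed_hom[of "e' x"] e'k[OF x] by simp
    ultimately have "fp_embed F (e' x) \<circ> J \<in> hom (V x) ?K" by (rule Group.hom_compose)
    then show ?thesis by (simp add: h_def V_def comp_def)
  qed
  have t_closed: "t x \<in> carrier ?K" if "x \<in> objects" for x
    using that FP.fp_embed_closed[of k] letter q'm by (auto simp: t_def Q_def)
  have t_base: "t x = \<one>\<^bsub>?K\<^esub>" if "x \<in> objects" "base x = x" for x
    using that by (simp add: t_def)
  obtain \<Psi> where \<Psi>: "\<Psi> \<in> hom G ?K"
    and \<Psi>_h: "\<And>x a. x \<in> objects \<Longrightarrow> base x = x \<Longrightarrow> a \<in> arrows x x \<Longrightarrow> \<Psi> a = h x a"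
    and \<Psi>_t: "\<And>x. x \<in> objects \<Longrightarrow> \<Psi> (link x) = t x"
    by (rule block_set_universal[OF FP.group_FP, of h t])
      (use hom_h t_closed t_base in \<open>assumption | blast\<close>)+
  define \<phi>\<^sub>i where "\<phi>\<^sub>i = (\<lambda>i. if i < k then J' (e i) else fg_lift G (\<lambda>j. link (q j)))"
  have hom_\<phi>\<^sub>i: "\<phi>\<^sub>i i \<in> hom (F i) G" if "i \<in> {..k}" for i
  proof (cases "i < k")
    case True
    then have J'_hom: "J' (e i) \<in> hom (F i) (V (e i))" using H(3) Fi by simp
    have "J' (e i) g \<in> arrows (e i) (e i)" if "g \<in> carrier (F i)" for g
      using J'_hom that by (auto simp: hom_def V_def)
    then have "J' (e i) g \<in> carrier G" if "g \<in> carrier (F i)" for g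
      using that arrow_closed by blast
    then show ?thesis using J'_hom True by (auto simp: \<phi>\<^sub>i_def hom_def V_def)
  next
    case False
    then have "i = k" using that by simp
    then show ?thesis using fg_lift_hom[of m "\<lambda>j. link (q j)"] by (simp add: \<phi>\<^sub>i_def Fk)
  qed
  define \<phi> where "\<phi> = fp_lift G \<phi>\<^sub>i"
  have \<phi>: "\<phi> \<in> hom ?K G"
    unfolding \<phi>_def by (rule FP.fp_lift_hom[OF group_axioms hom_\<phi>\<^sub>i])
  have \<phi>_embed: "\<phi> (fp_embed F i g) = \<phi>\<^sub>i i g" if "i \<le> k" "g \<in> carrier (F i)" for i g
    unfolding \<phi>_def by (rule FP.fp_lift_embed[OF group_axioms hom_\<phi>\<^sub>i]) (use that in auto)
  interpret Psi: group_hom G ?K \<Psi> by unfold_locales (rule \<Psi>)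
  interpret Phi: group_hom ?K G \<phi> by unfold_locales (rule \<phi>)
  have \<phi>_h: "\<phi> (h x a) = a" if "x \<in> objects" "base x = x" "a \<in> arrows x x" for x a
  proof -
    have x: "x \<in> R" using that by (simp add: R_def)
    then have "J a \<in> carrier (F (e' x))" using that(3) by (simp add: Fi e'k H_carrier ee')
    then show ?thesis
      using \<phi>_embed[of "e' x" "J a"] e'k[OF x] ee'[OF x] that(3) by (simp add: h_def \<phi>\<^sub>i_def J'J)
  qed
  have \<phi>_letter: "\<phi> (fp_embed F k [(j, True)]) = link (q j)" if "j < m" for j
    using \<phi>_embed[of k] letter[OF that] by (simp add: \<phi>\<^sub>i_def fg_lift_def)
  have \<phi>_t: "\<phi> (t x) = link x" if "x \<in> objects" for x
  proof (cases "base x = x")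
    case True
    then show ?thesis by (simp add: t_def link_def)
  next
    case False
    then have "x \<in> Q" using that by (simp add: Q_def)
    then show ?thesis using False \<phi>_letter[OF q'm] by (simp add: t_def qq')
  qed
  \<comment> \<open>Moved by links to the base object, \<open>a\<close> becomes an element of a
    vertex group. The composite fixes that element and both links, hence also
    \<open>a\<close>.\<close>
  have \<phi>\<Psi>_P: "\<phi> (\<Psi> a) = a" if "a \<in> P - {\<one>}" for a
  proof -
    let ?x = "src a" and ?y = "src (inv a)"
    let ?h = "link ?x \<otimes> a \<otimes> inv (link ?y)"
    have obj: "?x \<in> objects" "?y \<in> objects" using src_objects that by auto
    have a: "a \<in> carrier G" using that by simp
    have h_arrow: "?h \<in> arrows (base ?x) (base ?x)" by (rule conjugate_link[OF mem_arrows[OF that]])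
    have "\<phi> (\<Psi> ?h) = ?h"
      using \<Psi>_h[OF base_objects[OF obj(1)] base_base h_arrow]
        \<phi>_h[OF base_objects[OF obj(1)] base_base h_arrow] by simp
    moreover have "\<phi> (\<Psi> (link ?x)) = link ?x" "\<phi> (\<Psi> (link ?y)) = link ?y"
      using \<Psi>_t \<phi>_t obj by auto
    ultimately have "link ?x \<otimes> \<phi> (\<Psi> a) \<otimes> inv (link ?y) = ?h"
      using a by simp
    then show ?thesis using a by simp
  qed
  have \<phi>\<Psi>: "\<phi> (\<Psi> g) = g" if g: "g \<in> carrier G" for g
  proof -
    obtain w where w: "set w \<subseteq> P - {\<one>}" "word_value G w = g" using word_in_P[OF g] .
    have "\<phi> (\<Psi> (word_value G w)) = word_value G w"
      using w(1)
    proof (induction w)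
      case (Cons a w)
      then have "set w \<subseteq> carrier G" by auto
      then show ?case using Cons \<phi>\<Psi>_P[of a] by simp
    qed simp
    then show ?thesis using w(2) by simp
  qed
  have \<Psi>\<phi>_embed: "\<Psi> (\<phi> (fp_embed F i g)) = fp_embed F i g" if ig: "i \<in> {..k}" "g \<in> carrier (F i)" for i g
  proof (cases "i < k")
    case True
    obtain a where a: "g = J a" "a \<in> arrows (e i) (e i)"
      using ig(2) True by (auto simp: Fi H_carrier)
    have "e i \<in> objects" "base (e i) = e i" using eR[OF True] by (auto simp: R_def)
    then have "\<Psi> a = fp_embed F i g" using \<Psi>_h a e'e[OF True] by (simp add: h_def)
    then show ?thesis using \<phi>_embed[of i g] ig True a by (simp add: \<phi>\<^sub>i_def J'J)
  next
    case False
    then have i: "i = k" using ig(1) by simp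
    \<comment> \<open>On the free factor it suffices to compare two homomorphisms on the free
      generators.\<close>
    have "\<Psi> \<circ> (\<phi> \<circ> fp_embed F k) \<in> hom (free_group m) ?K"
      by (rule Group.hom_compose[OF Group.hom_compose[OF embed_k \<phi>] \<Psi>])
    moreover have "(\<Psi> \<circ> (\<phi> \<circ> fp_embed F k)) [(j, True)] = fp_embed F k [(j, True)]" if "j < m" for j
      using \<phi>_letter[OF that] \<Psi>_t[of "q j"] qQ[OF that] q'q[OF that] by (simp add: Q_def t_def)
    ultimately have "(\<Psi> \<circ> (\<phi> \<circ> fp_embed F k)) g = fp_embed F k g"
      using K.free_group_hom_unique embed_k ig(2) i Fk by metis
    then show ?thesis using i by simp
  qed
  have \<Psi>\<phi>: "\<Psi> (\<phi> w) = w" if "w \<in> carrier ?K" for w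
  proof -
    have "(\<Psi> \<circ> \<phi>) w = (\<lambda>w. w) w"
    proof (rule FP.FP_hom_unique[OF FP.group_FP _ _ _ that])
      show "\<Psi> \<circ> \<phi> \<in> hom ?K ?K" by (rule Group.hom_compose[OF \<phi> \<Psi>])
      show "(\<lambda>w. w) \<in> hom ?K ?K" by (auto simp: hom_def)
    qed (use \<Psi>\<phi>_embed in auto)
    then show ?thesis by simp
  qed
  have "bij_betw \<Psi> (carrier G) (carrier ?K)"
    by (rule bij_betw_byWitness[of _ \<phi>]) (use \<phi>\<Psi> \<Psi>\<phi> in auto)
  then have "\<Psi> \<in> iso G ?K" using \<Psi> unfolding iso_def by blast
  then have "G \<cong> ?K" by (rule is_isoI)
  moreover have "finite (carrier (H i))" for i
    using finite_P arrows_P[of "e i" "e i"] by (auto simp: H_carrier intro: finite_subset)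
  ultimately show ?thesis
    unfolding plain_group_def F_def using H(1) by blast
qed

end


section \<open>Plain groups have a block set\<close>

lemma block_set_transport:
  assumes "block_set K P" "group G" and \<phi>: "\<phi> \<in> iso K G"
  shows "block_set G (\<phi> ` P)"
proof -
  interpret K: block_set K P by fact
  interpret G: group G by fact
  interpret phi: group_hom K G \<phi> by unfold_locales (use \<phi> in \<open>auto simp: iso_def\<close>)
  have inj: "inj_on \<phi> (carrier K)" and surj: "\<phi> ` carrier K = carrier G"
    using \<phi> by (auto simp: iso_def bij_betw_def)
  have eq_iff: "\<phi> a = \<phi> b \<longleftrightarrow> a = b" if "a \<in> carrier K" "b \<in> carrier K" for a b
    using inj that by (auto simp: inj_on_def)
  have mem_iff: "\<phi> a \<in> \<phi> ` P \<longleftrightarrow> a \<in> P" if "a \<in> carrier K" for a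
    using that eq_iff by auto
  show ?thesis
  proof
    show "finite (\<phi> ` P)" using K.finite_P by simp
    show "\<phi> ` P \<subseteq> carrier G" by auto
    show "\<one>\<^bsub>G\<^esub> \<in> \<phi> ` P" using K.one_P phi.hom_one by force
    show "inv\<^bsub>G\<^esub> a \<in> \<phi> ` P" if "a \<in> \<phi> ` P" for a
      using that K.inv_P by (auto simp flip: phi.hom_inv)
    show "generate G (\<phi> ` P) = carrier G"
      using phi.generate_img[OF K.P_carrier] K.generate_P surj by simp
    show "a \<otimes>\<^bsub>G\<^esub> b \<otimes>\<^bsub>G\<^esub> c \<in> \<phi> ` P"
      if "a \<in> \<phi> ` P" "b \<in> \<phi> ` P" "c \<in> \<phi> ` P" "b \<noteq> \<one>\<^bsub>G\<^esub>" "a \<otimes>\<^bsub>G\<^esub> b \<in> \<phi> ` P" "b \<otimes>\<^bsub>G\<^esub> c \<in> \<phi> ` P"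
      for a b c
    proof -
      obtain a' b' c' where abc: "a = \<phi> a'" "b = \<phi> b'" "c = \<phi> c'" "a' \<in> P" "b' \<in> P" "c' \<in> P"
        using \<open>a \<in> _\<close> \<open>b \<in> _\<close> \<open>c \<in> _\<close> by auto
      have "b' \<noteq> \<one>\<^bsub>K\<^esub>" using \<open>b \<noteq> _\<close> abc by auto
      moreover have "a' \<otimes>\<^bsub>K\<^esub> b' \<in> P" "b' \<otimes>\<^bsub>K\<^esub> c' \<in> P"
        using that(5,6) abc mem_iff by (simp_all flip: phi.hom_mult)
      ultimately have "a' \<otimes>\<^bsub>K\<^esub> b' \<otimes>\<^bsub>K\<^esub> c' \<in> P" using K.triple abc by blast
      then show ?thesis using abc by (simp flip: phi.hom_mult)
    qed
    show "word_value G w \<noteq> \<one>\<^bsub>G\<^esub>"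
      if w: "set w \<subseteq> \<phi> ` P - {\<one>\<^bsub>G\<^esub>}" "w \<noteq> []" "successively (\<lambda>a b. a \<otimes>\<^bsub>G\<^esub> b \<notin> \<phi> ` P) w" for w
    proof -
      have "w \<in> lists (\<phi> ` P)" using w by auto
      then obtain v where v: "w = map \<phi> v" "set v \<subseteq> P"
        by (auto simp: lists_image)
      have vc: "set v \<subseteq> carrier K" using v by auto
      have "word_value G (map \<phi> v) = \<phi> (word_value K v)"
        using vc by (induction v) auto
      moreover have "word_value K v \<noteq> \<one>\<^bsub>K\<^esub>"
      proof (rule K.reduced)
        show "set v \<subseteq> P - {\<one>\<^bsub>K\<^esub>}" using v w by auto
        show "successively (\<lambda>a b. a \<otimes>\<^bsub>K\<^esub> b \<notin> P) v"
          using w(3) unfolding v(1) successively_map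
        proof (rule successively_mono)
          fix x y assume "x \<in> set v" "y \<in> set v" "\<phi> x \<otimes>\<^bsub>G\<^esub> \<phi> y \<notin> \<phi> ` P"
          moreover from this have "x \<in> carrier K" "y \<in> carrier K" using vc by auto
          ultimately show "x \<otimes>\<^bsub>K\<^esub> y \<notin> P" using phi.hom_mult[of x y] by force
        qed
      qed (use v w in auto)
      ultimately show ?thesis
        using eq_iff[of "word_value K v" "\<one>\<^bsub>K\<^esub>"] K.word_value_closed[OF vc] v(1) by simp
    qed
  qed
qed

locale plain_factors = factors "{..k}" F for k :: nat and F :: "nat \<Rightarrow> (nat \<times> bool) list monoid" +
  fixes m :: nat
  assumes finite_factor: "i < k \<Longrightarrow> finite (carrier (F i))"
    and last_factor: "F k = free_group m"
begin

text \<open>The free factor may be infinite, so it contributes only its generators and their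
  inverses; this keeps the block set finite.\<close>

definition plain_letters :: "nat \<Rightarrow> (nat \<times> bool) list set" where
  "plain_letters i = (if i < k then carrier (F i) - {\<one>\<^bsub>F i\<^esub>} else {[s] |s. fst s < m})"

definition plain_block :: "(nat \<times> (nat \<times> bool) list) list set" where
  "plain_block = insert [] {[(i, g)] |i g. i \<le> k \<and> g \<in> plain_letters i}"

sublocale K: group FP by (rule group_FP)

lemma plain_letters_F: "i \<le> k \<Longrightarrow> g \<in> plain_letters i \<Longrightarrow> g \<in> carrier (F i) \<and> g \<noteq> \<one>\<^bsub>F i\<^esub>"
  by (cases "i = k")
    (auto simp: plain_letters_def last_factor free_group_def fg_words_Cons fg_words_Nil)

lemma plain_block_carrier: "plain_block \<subseteq> carrier FP"
  using plain_letters_F by (fastforce simp: plain_block_def carrier_FP fp_words_Cons fp_words_Nil)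

lemma letter_mult:
  assumes "i \<le> k" "g \<in> plain_letters i" "w \<in> fp_words {..k} F"
  shows "[(i, g)] \<otimes>\<^bsub>FP\<^esub> w = fp_cons F (i, g) w"
  using plain_letters_F[OF assms(1,2)] assms fp_embed_mult[of i g w]
  by (simp add: fp_embed_def fp_cons_def)

lemma letter_word: "i \<le> k \<Longrightarrow> g \<in> plain_letters i \<Longrightarrow> [(i, g)] \<in> fp_words {..k} F"
  using plain_letters_F by (auto simp: fp_words_Cons fp_words_Nil)

text \<open>Two letters of the free factor cancel or form a word of length two, never a single
  letter, and syllables of different factors stay apart.\<close>

lemma letters_mult_iff:
  assumes "i \<le> k" "g \<in> plain_letters i" "j \<le> k" "h \<in> plain_letters j"
  shows "[(i, g)] \<otimes>\<^bsub>FP\<^esub> [(j, h)] \<in> plain_block \<longleftrightarrow>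
    i = j \<and> (i < k \<or> [(i, g)] \<otimes>\<^bsub>FP\<^esub> [(j, h)] = \<one>\<^bsub>FP\<^esub>)"
proof (cases "i = j")
  case True
  have g: "g \<in> carrier (F i)" "h \<in> carrier (F i)" "g \<noteq> \<one>\<^bsub>F i\<^esub>"
    using plain_letters_F assms True by auto
  have eq: "[(i, g)] \<otimes>\<^bsub>FP\<^esub> [(j, h)] =
      (if g \<otimes>\<^bsub>F i\<^esub> h = \<one>\<^bsub>F i\<^esub> then [] else [(i, g \<otimes>\<^bsub>F i\<^esub> h)])"
    using letter_mult[OF assms(1,2) letter_word[OF assms(3,4)]] True g
    by (simp add: fp_cons_def)
  show ?thesis
  proof (cases "i < k")
    case ik: True
    then interpret Hi: group "F i" using group_factor by simp
    have "g \<otimes>\<^bsub>F i\<^esub> h \<in> carrier (F i)" using g ik by simp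
    then show ?thesis using eq True ik by (auto simp: plain_block_def plain_letters_def)
  next
    case False
    then have ik: "i = k" using assms by simp
    obtain s t where st: "g = [s]" "h = [t]"
      using assms False True by (auto simp: plain_letters_def)
    have "g \<otimes>\<^bsub>F i\<^esub> h \<notin> plain_letters i"
      using st False ik by (auto simp: plain_letters_def last_factor free_group_def fg_cons_def)
    then show ?thesis using eq True ik unfolding plain_block_def one_FP by auto
  qed
next
  case False
  have "[(i, g)] \<otimes>\<^bsub>FP\<^esub> [(j, h)] = [(i, g), (j, h)]"
    using letter_mult[OF assms(1,2) letter_word[OF assms(3,4)]] False plain_letters_F[OF assms(1,2)]
    by (simp add: fp_cons_def)
  then show ?thesis using False by (auto simp: plain_block_def)
qed

text \<open>The induction has to know how the value begins. A syllable of a finite factor is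
  followed by one of another factor and stays intact, whereas a letter of the free factor may absorb
  letters after it, whence the tail \<open>u\<close>. In either case the value is not the empty
  word.\<close>

lemma plain_reduced_head:
  assumes "set w \<subseteq> plain_block - {[]}" "successively (\<lambda>a b. a \<otimes>\<^bsub>FP\<^esub> b \<notin> plain_block) w"
    "w = [(i, g)] # w'"
  shows "\<exists>u v. word_value FP w = (i, if i < k then g else g @ u) # v"
  using assms
proof (induction w arbitrary: i g w')
  case (Cons x w)
  have x: "x = [(i, g)]" "w' = w" using Cons.prems by auto
  have ig: "i \<le> k" "g \<in> plain_letters i" using Cons.prems(1) x by (auto simp: plain_block_def)
  show ?case
  proof (cases w)
    case Nil
    then show ?thesis
      using x K.r_one[of "[(i, g)]"] letter_word[OF ig]
      by (auto simp: carrier_FP intro!: exI[of _ "[]"])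
  next
    case w: (Cons y w2)
    then obtain j h where y: "y = [(j, h)]" "j \<le> k" "h \<in> plain_letters j"
      using Cons.prems(1) by (auto simp: plain_block_def)
    obtain u v where uv: "word_value FP w = (j, if j < k then h else h @ u) # v"
      using Cons.IH[of j h w2] Cons.prems w y by auto
    have "set w \<subseteq> carrier FP" using Cons.prems(1) plain_block_carrier by auto
    then have "word_value FP w \<in> fp_words {..k} F"
      using K.word_value_closed by (simp add: carrier_FP)
    then have val: "word_value FP (x # w) = fp_cons F (i, g) (word_value FP w)"
      using letter_mult[OF ig] x by simp
    have xy: "\<not> (i = j \<and> (i < k \<or> [(i, g)] \<otimes>\<^bsub>FP\<^esub> [(j, h)] = \<one>\<^bsub>FP\<^esub>))"
      using letters_mult_iff[OF ig y(2,3)] Cons.prems(2) x y w by auto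
    show ?thesis
    proof (cases "i = j")
      case False
      then show ?thesis
        using val uv plain_letters_F[OF ig] by (auto simp: fp_cons_def intro: exI[of _ "[]"])
    next
      case True
      then have ik: "\<not> i < k" "i = k" using xy ig by auto
      obtain s t where st: "g = [s]" "h = [t]"
        using ig y True ik by (auto simp: plain_letters_def)
      have "[(i, g)] \<otimes>\<^bsub>FP\<^esub> [(j, h)] \<noteq> []" using xy True by (simp add: one_FP)
      \<comment> \<open>In the free factor, a product outside the block set means that the two
        letters do not cancel.\<close>
      then have "t \<noteq> letter_inv s"
        using letter_mult[OF ig letter_word[OF y(2,3)]] ik st
        unfolding True[symmetric] ik(2) by (auto simp: fp_cons_def last_factor free_group_def fg_cons_def)
      then show ?thesis
        using val uv ik st unfolding True[symmetric] ik(2)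
        by (auto simp: fp_cons_def last_factor free_group_def fg_cons_def)
    qed
  qed
qed simp

lemma plain_block_generates: "carrier FP \<subseteq> generate FP plain_block"
proof
  have sub: "subgroup (generate FP plain_block) FP"
    by (rule K.generate_is_subgroup[OF plain_block_carrier])
  have letter: "fp_embed F i g \<in> generate FP plain_block" if "i \<le> k" "g \<in> plain_letters i" for i g
    using that plain_letters_F[OF that]
    by (intro generate.incl) (auto simp: fp_embed_def fp_cons_def plain_block_def)
  have one: "fp_embed F i \<one>\<^bsub>F i\<^esub> \<in> generate FP plain_block" for i
    using generate.one[of FP plain_block] by (simp add: fp_embed_def fp_cons_def one_FP)
  have free: "fp_embed F k u \<in> generate FP plain_block" if "u \<in> fg_words m" for u
    using that
  proof (induction u)
    case Nil
    then show ?case using one[of k] by (simp add: last_factor free_group_def)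
  next
    case (Cons s u)
    have c: "[s] \<in> carrier (F k)" "u \<in> carrier (F k)"
      using Cons.prems by (auto simp: last_factor free_group_def fg_words_Cons fg_words_Nil)
    have "s # u = [s] \<otimes>\<^bsub>F k\<^esub> u"
      using Cons.prems by (cases u) (auto simp: last_factor free_group_def fg_cons_def fg_words_Cons)
    then have "fp_embed F k (s # u) = fp_embed F k [s] \<otimes>\<^bsub>FP\<^esub> fp_embed F k u"
      using hom_mult[OF fp_embed_hom c] by simp
    moreover have "[s] \<in> plain_letters k"
      using Cons.prems by (cases s) (simp add: plain_letters_def fg_words_Cons)
    ultimately show ?case
      using letter[of k "[s]"] Cons subgroup.m_closed[OF sub] by (auto simp: fg_words_Cons)
  qed
  have embed: "fp_embed F i g \<in> generate FP plain_block" if "i \<le> k" "g \<in> carrier (F i)" for i g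
  proof (cases "i < k")
    case True
    then show ?thesis
      using that letter[of i g] one[of i] by (cases "g = \<one>\<^bsub>F i\<^esub>") (auto simp: plain_letters_def)
  next
    case False
    then show ?thesis using that free[of g] by (simp add: last_factor free_group_def)
  qed
  fix w assume "w \<in> carrier FP"
  then have "w \<in> fp_words {..k} F" by (simp add: carrier_FP)
  then show "w \<in> generate FP plain_block"
  proof (induction w)
    case Nil
    then show ?case using generate.one[of FP plain_block] by (simp add: one_FP)
  next
    case (Cons p w)
    obtain i g where p: "p = (i, g)" by (cases p)
    then show ?case
      using Cons.IH Cons.prems Cons_eq_fp_embed_mult[of i g w] embed[of i g]
        subgroup.m_closed[OF sub, of "fp_embed F i g" w]
      by (simp add: fp_words_Cons)
  qed
qed

lemma finite_plain_block: "finite plain_block"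
proof -
  have "{[s] |s. fst s < m} = (\<lambda>s. [s]) ` ({..<m} \<times> (UNIV :: bool set))" by force
  then have "finite (plain_letters i)" for i using finite_factor by (auto simp: plain_letters_def)
  moreover have "{[(i, g)] |i g. i \<le> k \<and> g \<in> plain_letters i} =
      (\<lambda>p. [p]) ` (SIGMA i:{..k}. plain_letters i)"
    by force
  ultimately show ?thesis by (simp add: plain_block_def)
qed

lemma plain_block_inv: "a \<in> plain_block \<Longrightarrow> inv\<^bsub>FP\<^esub> a \<in> plain_block"
proof -
  assume a: "a \<in> plain_block"
  show ?thesis
  proof (cases "a = []")
    case True
    then show ?thesis using K.inv_one a by (simp add: one_FP)
  next
    case False
    then obtain i g where ig: "a = [(i, g)]" "i \<le> k" "g \<in> plain_letters i"
      using a by (auto simp: plain_block_def)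
    obtain h where h: "h \<in> plain_letters i" "h \<otimes>\<^bsub>F i\<^esub> g = \<one>\<^bsub>F i\<^esub>"
    proof (cases "i < k")
      case True
      then interpret Hi: group "F i" using group_factor by simp
      have "inv\<^bsub>F i\<^esub> g \<in> plain_letters i" "inv\<^bsub>F i\<^esub> g \<otimes>\<^bsub>F i\<^esub> g = \<one>\<^bsub>F i\<^esub>"
        using ig True by (auto simp: plain_letters_def)
      then show ?thesis by (rule that)
    next
      case False
      then obtain s where s: "g = [s]" "fst s < m" using ig by (auto simp: plain_letters_def)
      have "[letter_inv s] \<in> plain_letters i" "[letter_inv s] \<otimes>\<^bsub>F i\<^esub> g = \<one>\<^bsub>F i\<^esub>"
        using s False ig by (auto simp: plain_letters_def letter_inv_def last_factor free_group_def fg_cons_def)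
      then show ?thesis by (rule that)
    qed
    have "[(i, h)] \<otimes>\<^bsub>FP\<^esub> a = \<one>\<^bsub>FP\<^esub>"
      using letter_mult[OF ig(2) h(1) letter_word[OF ig(2,3)]] h ig plain_letters_F[OF ig(2) h(1)]
      by (simp add: fp_cons_def one_FP)
    then have "inv\<^bsub>FP\<^esub> a = [(i, h)]"
      using K.inv_equality letter_word ig h by (simp add: carrier_FP)
    then show ?thesis using ig h by (auto simp: plain_block_def)
  qed
qed

lemma block_set_plain_block: "block_set FP plain_block"
proof
  show "finite plain_block" by (rule finite_plain_block)
  show "plain_block \<subseteq> carrier FP" by (rule plain_block_carrier)
  show "\<one>\<^bsub>FP\<^esub> \<in> plain_block" by (simp add: plain_block_def one_FP)
  show "inv\<^bsub>FP\<^esub> a \<in> plain_block" if "a \<in> plain_block" for a using plain_block_inv that .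
  show "generate FP plain_block = carrier FP"
    using plain_block_generates K.generate_incl[OF plain_block_carrier] by blast
  show "a \<otimes>\<^bsub>FP\<^esub> b \<otimes>\<^bsub>FP\<^esub> c \<in> plain_block"
    if abc: "a \<in> plain_block" "b \<in> plain_block" "c \<in> plain_block" "b \<noteq> \<one>\<^bsub>FP\<^esub>"
      "a \<otimes>\<^bsub>FP\<^esub> b \<in> plain_block" "b \<otimes>\<^bsub>FP\<^esub> c \<in> plain_block" for a b c
  proof (cases "a = \<one>\<^bsub>FP\<^esub> \<or> c = \<one>\<^bsub>FP\<^esub> \<or> a \<otimes>\<^bsub>FP\<^esub> b = \<one>\<^bsub>FP\<^esub>")
    case True
    have "a \<in> carrier FP" "b \<in> carrier FP" "c \<in> carrier FP" using abc plain_block_carrier by auto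
    then show ?thesis using True abc by auto
  next
    case False
    then obtain i g j h l f where
      a: "a = [(i, g)]" "i \<le> k" "g \<in> plain_letters i" and
      b: "b = [(j, h)]" "j \<le> k" "h \<in> plain_letters j" and
      c: "c = [(l, f)]" "l \<le> k" "f \<in> plain_letters l"
      using abc by (auto simp: plain_block_def one_FP)
    \<comment> \<open>The product of two letters can be a letter only within a finite factor, so
      here all three come from the same finite factor.\<close>
    have eq: "i = j" "i < k" "j = l"
      using letters_mult_iff[OF a(2,3) b(2,3)] letters_mult_iff[OF b(2,3) c(2,3)] abc a b c False
      by auto
    obtain g' where g': "a \<otimes>\<^bsub>FP\<^esub> b = [(i, g')]" "g' \<in> plain_letters i"
      using abc(5) False letter_mult[OF a(2,3) letter_word[OF b(2,3)]] a b eq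
      by (auto simp: plain_block_def fp_cons_def one_FP split: if_splits)
    then show ?thesis
      using letters_mult_iff[OF a(2) g'(2) c(2,3)] eq c by simp
  qed
  show "word_value FP w \<noteq> \<one>\<^bsub>FP\<^esub>"
    if w: "set w \<subseteq> plain_block - {\<one>\<^bsub>FP\<^esub>}" "w \<noteq> []"
      "successively (\<lambda>a b. a \<otimes>\<^bsub>FP\<^esub> b \<notin> plain_block) w" for w
  proof -
    obtain x w' where x: "w = x # w'" using w(2) by (cases w) auto
    moreover obtain i g where "x = [(i, g)]" using w(1) x by (auto simp: plain_block_def one_FP)
    ultimately show ?thesis using plain_reduced_head[of w i g w'] w by (auto simp: one_FP)
  qed
qed

end

lemma plain_group_block_set:
  assumes "group G" "plain_group G"
  shows "\<exists>P. block_set G P"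
proof -
  obtain k m and H :: "nat \<Rightarrow> (nat \<times> bool) list monoid"
    where H: "\<forall>i<k. group (H i) \<and> finite (carrier (H i))"
      and iso: "G \<cong> free_product {..k} (H(k := free_group m))"
    using assms(2) by (auto simp: plain_group_def)
  interpret plain_factors k "H(k := free_group m)" m
    by (rule plain_factors.intro, rule factors.intro, unfold plain_factors_axioms_def)
      (use H in \<open>auto simp: group_free_group\<close>)
  obtain \<phi> where "\<phi> \<in> iso FP G"
    using group.iso_sym[OF assms(1) iso] by (auto simp: is_iso_def)
  then show ?thesis
    using block_set_transport[OF block_set_plain_block assms(1)] by blast
qed


theorem theorem1:
  fixes G :: "('a, 'b) monoid_scheme"
  assumes "group G" and "finitely_generated G"
  shows "(\<exists>S. generating_set G S \<and> SFT S (skeleton G S)) \<longleftrightarrow> plain_group G"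
proof
  assume "\<exists>S. generating_set G S \<and> SFT S (skeleton G S)"
  then obtain S where S: "generating_set G S" "SFT S (skeleton G S)" by blast
  interpret group G by fact
  obtain N where "\<forall>w. simple_loop G w \<and> set w \<subseteq> S \<longrightarrow> length w \<le> N"
    using simple_loops_bounded_if_SFT[of S] S by (auto simp: generating_set_def)
  then interpret cayley G S N by unfold_locales (use S in auto)
  show "plain_group G" by (rule block_set.plain_group[OF block_set_insep])
next
  assume "plain_group G"
  then obtain P where "block_set G P" using plain_group_block_set assms(1) by blast
  then interpret block_set G P .
  show "\<exists>S. generating_set G S \<and> SFT S (skeleton G S)"
    using generating_set_P simple_loop_length finite_P
    by (intro exI[of _ "P - {\<one>\<^bsub>G\<^esub>}"] conjI SFT_skeleton_if_simple_loops_bounded) auto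
qed

end
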